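(* Let $M\in(\overline{\Lambda}^{(1)})^{p\times p}$. Then the following statements are equivalent: (i) $M$ is superpositive; (ii) $M$ is self-adjoint ($M^*=M$) and its body $M_B\in\mathbb{C}^{p\times p}$ is positive (i.e. positive definite); (iii) $M=LDU$, where $D$ is a superpositive diagonal matrix, $L$ is a lower triangular matrix with main diagonal composed of ones, and $U=L^*$; (iv) $M=LL^*=UU^*$, where $L,U\in(\overline{\Lambda}^{(1)})^{p\times p}$, and $L$ and $U$ are, respectively, lower and upper triangular matrices and their main diagonals are composed of ones.
   Context: $\Lambda$ is the unital complex algebra generated by $1$ and countably many elements $i_1,i_2,\ldots$, linearly independent over $\mathbb{C}$, with $i_ni_m+i_mi_n=0$ for all $n,m$ (so $i_n^2=0$). Let $\mathfrak{I}$ be the set of finite strictly increasing nonempty tuples $\alpha=(a_1<\cdots<a_t)$ of positive integers, $|\alpha|=t$, $i_\alpha=i_{a_1}\cdots i_{a_t}$, $\mathfrak{I}_0=\mathfrak{I}\cup\{0\}$, $i_0=1$. $\overline{\Lambda}^{(1)}$ is the Banach algebra of all sums $z=\sum_{\alpha\in\mathfrak{I}_0}z_\alpha i_\alpha$, $z_\alpha\in\mathbb{C}$, with $\|z\|_1=\sum_{\alpha\in\mathfrak{I}_0}|z_\alpha|<\infty$ (the completion of $\Lambda$ in this norm); its elements are called supernumbers. The body of $z$ is $z_B=z_0$; the body of a matrix is taken entrywise. The conjugation $\dag$ is $z^\dag=\overline{z_0}+\sum_{\alpha\in\mathfrak I}(-1)^{|\alpha|(|\alpha|-1)/2}\,\overline{z_\alpha}\,i_\alpha$;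 it satisfies $(zw)^\dag=w^\dag z^\dag$. For a matrix $M=(m_{jk})$, $M^*$ is the matrix with $(j,k)$ entry $m_{kj}^\dag$. A supernumber $z\in\overline{\Lambda}^{(1)}$ is positive, written $z\succ0$, if $z$ is invertible and $z=ww^\dag$ for some $w\in\overline{\Lambda}^{(1)}$. A matrix $M\in(\overline{\Lambda}^{(1)})^{p\times p}$ is superpositive if $c^*Mc\succ 0$ for every $c\in(\overline{\Lambda}^{(1)})^{p\times 1}$ with $c_B\neq 0$. All matrices have entries in $\overline{\Lambda}^{(1)}$.
   Formalization: In (iv) the main diagonals of L and U are composed of positive supernumbers instead of ones; with ones the equivalence fails, e.g. for p = 1 and M = (2), which satisfies (i)–(iii) but is not LL* with L = (1). *)

theory Defs
  imports "HOL-Analysis.Infinite_Sum" "Jordan_Normal_Form.Matrix" "Jordan_Normal_Form.Conjugate"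
begin

section \<open>Supernumbers\<close>

text \<open>A strictly increasing finite tuple of positive integers is encoded by the set of its
  entries; the empty set plays the role of the index \<open>0\<close> (with \<open>i\<^sub>0 = 1\<close>).\<close>

definition multi_indices :: "nat set set" where
  "multi_indices = {\<alpha>. finite \<alpha> \<and> 0 \<notin> \<alpha>}"

text \<open>A supernumber is the family of its coefficients, \<open>\<Sum>\<^sub>\<alpha> z\<^sub>\<alpha> i\<^sub>\<alpha>\<close> with
  \<open>\<Sum>\<^sub>\<alpha> |z\<^sub>\<alpha>| < \<infinity>\<close>.\<close>

typedef supernumber =
  "{z :: nat set \<Rightarrow> complex.
      (\<forall>\<alpha>. \<alpha> \<notin> multi_indices \<longrightarrow> z \<alpha> = 0) \<and>
      (\<lambda>\<alpha>. cmod (z \<alpha>)) summable_on multi_indices}"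
  morphisms coef Supernumber
  by (rule exI[of _ "\<lambda>_. 0"]) auto

setup_lifting type_definition_supernumber

lemma coef_outside: "\<alpha> \<notin> multi_indices \<Longrightarrow> coef z \<alpha> = 0"
  using coef[of z] by auto

lemma coef_summable: "(\<lambda>\<alpha>. cmod (coef z \<alpha>)) summable_on multi_indices"
  using coef[of z] by auto

lemma supernumber_eqI: "(\<And>\<alpha>. coef z \<alpha> = coef w \<alpha>) \<Longrightarrow> z = w"
  by (simp add: coef_inject[symmetric] ext)

lemma summable_cmod_add:
  assumes "(\<lambda>\<alpha>. cmod (f \<alpha>)) summable_on A" "(\<lambda>\<alpha>. cmod (g \<alpha>)) summable_on A"
  shows "(\<lambda>\<alpha>. cmod (f \<alpha> + g \<alpha>)) summable_on A"
proof (rule summable_on_comparison_test)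
  show "(\<lambda>\<alpha>. cmod (f \<alpha>) + cmod (g \<alpha>)) summable_on A"
    by (rule summable_on_add[OF assms])
qed (auto intro: norm_triangle_ineq)

lemma summable_cmod_diff:
  assumes "(\<lambda>\<alpha>. cmod (f \<alpha>)) summable_on A" "(\<lambda>\<alpha>. cmod (g \<alpha>)) summable_on A"
  shows "(\<lambda>\<alpha>. cmod (f \<alpha> - g \<alpha>)) summable_on A"
  using summable_cmod_add[of f A "\<lambda>\<alpha>. - g \<alpha>"] assms by simp

text \<open>The sign produced by sorting the juxtaposition of two increasing tuples: each pair
  out of order costs one application of \<open>i\<^sub>n i\<^sub>m = - i\<^sub>m i\<^sub>n\<close>.  Hence
  \<open>i\<^sub>\<alpha> i\<^sub>\<beta> = merge_sign \<alpha> \<beta> i\<^bsub>\<alpha> \<union> \<beta>\<^esub>\<close> for disjoint \<open>\<alpha>\<close>, \<open>\<beta>\<close>,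
  and \<open>i\<^sub>\<alpha> i\<^sub>\<beta> = 0\<close> otherwise.\<close>

definition merge_sign :: "nat set \<Rightarrow> nat set \<Rightarrow> complex" where
  "merge_sign \<alpha> \<beta> = (-1) ^ card {(a, b). a \<in> \<alpha> \<and> b \<in> \<beta> \<and> b < a}"

definition super_conv :: "(nat set \<Rightarrow> complex) \<Rightarrow> (nat set \<Rightarrow> complex) \<Rightarrow> nat set \<Rightarrow> complex" where
  "super_conv z w \<gamma> = (\<Sum>\<alpha>\<in>Pow \<gamma>. merge_sign \<alpha> (\<gamma> - \<alpha>) * z \<alpha> * w (\<gamma> - \<alpha>))"

lemma norm_merge_sign [simp]: "cmod (merge_sign \<alpha> \<beta>) = 1"
  by (simp add: merge_sign_def norm_power)

lemma merge_sign_empty [simp]: "merge_sign {} \<beta> = 1" "merge_sign \<alpha> {} = 1"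
  by (simp_all add: merge_sign_def)

lemma finite_inversions:
  "finite \<alpha> \<Longrightarrow> finite \<beta> \<Longrightarrow> finite {(a, b). a \<in> \<alpha> \<and> b \<in> \<beta> \<and> b < (a::nat)}"
  by (rule finite_subset[of _ "\<alpha> \<times> \<beta>"]) auto

lemma merge_sign_Un_left:
  assumes "finite \<alpha>" "finite \<beta>" "finite \<gamma>" "\<alpha> \<inter> \<beta> = {}"
  shows "merge_sign (\<alpha> \<union> \<beta>) \<gamma> = merge_sign \<alpha> \<gamma> * merge_sign \<beta> \<gamma>"
proof -
  have "{(a, b). a \<in> \<alpha> \<union> \<beta> \<and> b \<in> \<gamma> \<and> b < a} =
    {(a, b). a \<in> \<alpha> \<and> b \<in> \<gamma> \<and> b < a} \<union> {(a, b). a \<in> \<beta> \<and> b \<in> \<gamma> \<and> b < a}" by auto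
  moreover have "{(a, b). a \<in> \<alpha> \<and> b \<in> \<gamma> \<and> b < a} \<inter> {(a, b). a \<in> \<beta> \<and> b \<in> \<gamma> \<and> b < a} = {}"
    using assms(4) by auto
  ultimately show ?thesis
    by (simp add: merge_sign_def card_Un_disjoint finite_inversions assms power_add)
qed

lemma merge_sign_Un_right:
  assumes "finite \<alpha>" "finite \<beta>" "finite \<gamma>" "\<beta> \<inter> \<gamma> = {}"
  shows "merge_sign \<alpha> (\<beta> \<union> \<gamma>) = merge_sign \<alpha> \<beta> * merge_sign \<alpha> \<gamma>"
proof -
  have "{(a, b). a \<in> \<alpha> \<and> b \<in> \<beta> \<union> \<gamma> \<and> b < a} =
    {(a, b). a \<in> \<alpha> \<and> b \<in> \<beta> \<and> b < a} \<union> {(a, b). a \<in> \<alpha> \<and> b \<in> \<gamma> \<and> b < a}" by auto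
  moreover have "{(a, b). a \<in> \<alpha> \<and> b \<in> \<beta> \<and> b < a} \<inter> {(a, b). a \<in> \<alpha> \<and> b \<in> \<gamma> \<and> b < a} = {}"
    using assms(4) by auto
  ultimately show ?thesis
    by (simp add: merge_sign_def card_Un_disjoint finite_inversions assms power_add)
qed

lemma super_conv_infinite: "infinite \<gamma> \<Longrightarrow> super_conv z w \<gamma> = 0"
  by (simp add: super_conv_def)

lemma super_conv_outside:
  assumes "\<gamma> \<notin> multi_indices"
  shows "super_conv (coef z) (coef w) \<gamma> = 0"
proof (cases "finite \<gamma>")
  case True
  hence "0 \<in> \<gamma>" using assms by (auto simp: multi_indices_def)
  have "coef z \<alpha> = 0 \<or> coef w (\<gamma> - \<alpha>) = 0" for \<alpha>
    using \<open>0 \<in> \<gamma>\<close> by (cases "0 \<in> \<alpha>") (simp_all add: multi_indices_def coef_outside)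
  thus ?thesis unfolding super_conv_def by (intro sum.neutral) force
qed (simp add: super_conv_infinite)

lemma super_conv_sum_bound:
  assumes F: "finite F" "F \<subseteq> multi_indices"
  shows "(\<Sum>\<gamma>\<in>F. cmod (super_conv (coef z) (coef w) \<gamma>)) \<le>
    infsum (\<lambda>\<alpha>. cmod (coef z \<alpha>)) multi_indices * infsum (\<lambda>\<alpha>. cmod (coef w \<alpha>)) multi_indices"
proof -
  define A where "A = \<Union> (Pow ` F)"
  have finF: "finite \<gamma>" if "\<gamma> \<in> F" for \<gamma> using F that by (auto simp: multi_indices_def)
  have A: "finite A" "A \<subseteq> multi_indices"
    using F finF by (auto simp: A_def multi_indices_def intro: finite_subset)
  let ?f = "\<lambda>(\<alpha>, \<beta>). cmod (coef z \<alpha>) * cmod (coef w \<beta>)"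
  have "(\<Sum>\<gamma>\<in>F. cmod (super_conv (coef z) (coef w) \<gamma>)) \<le>
      (\<Sum>\<gamma>\<in>F. \<Sum>\<alpha>\<in>Pow \<gamma>. cmod (coef z \<alpha>) * cmod (coef w (\<gamma> - \<alpha>)))"
    unfolding super_conv_def
    by (intro sum_mono order.trans[OF norm_sum]) (simp add: norm_mult)
  also have "\<dots> = (\<Sum>(\<gamma>, \<alpha>)\<in>Sigma F Pow. cmod (coef z \<alpha>) * cmod (coef w (\<gamma> - \<alpha>)))"
    using F finF by (subst sum.Sigma) auto
  also have "\<dots> = sum ?f ((\<lambda>(\<gamma>, \<alpha>). (\<alpha>, \<gamma> - \<alpha>)) ` Sigma F Pow)"
    by (subst sum.reindex) (auto simp: inj_on_def case_prod_unfold)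
  also have "\<dots> \<le> sum ?f (A \<times> A)"
    using A by (intro sum_mono2) (auto simp: A_def)
  also have "\<dots> = (\<Sum>\<alpha>\<in>A. cmod (coef z \<alpha>)) * (\<Sum>\<alpha>\<in>A. cmod (coef w \<alpha>))"
    by (simp add: sum.cartesian_product[symmetric] sum_product)
  also have "\<dots> \<le> infsum (\<lambda>\<alpha>. cmod (coef z \<alpha>)) multi_indices * infsum (\<lambda>\<alpha>. cmod (coef w \<alpha>)) multi_indices"
    using A by (intro mult_mono finite_sum_le_infsum coef_summable infsum_nonneg sum_nonneg) auto
  finally show ?thesis .
qed

lemma super_conv_summable:
  "(\<lambda>\<gamma>. cmod (super_conv (coef z) (coef w) \<gamma>)) summable_on multi_indices"
proof (rule nonneg_bdd_above_summable_on)
  show "bdd_above (sum (\<lambda>\<gamma>. cmod (super_conv (coef z) (coef w) \<gamma>)) ` {F. F \<subseteq> multi_indices \<and> finite F})"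
    by (rule bdd_aboveI2, rule super_conv_sum_bound) auto
qed simp

lemma super_conv_assoc:
  "super_conv (super_conv z w) v \<gamma> = super_conv z (super_conv w v) \<gamma>"
proof (cases "finite \<gamma>")
  case fin: True
  have fs: "finite \<alpha>" if "\<alpha> \<subseteq> \<gamma>" for \<alpha> using fin that finite_subset by blast
  have "super_conv (super_conv z w) v \<gamma> = (\<Sum>(\<delta>, \<alpha>)\<in>Sigma (Pow \<gamma>) Pow.
      merge_sign \<delta> (\<gamma> - \<delta>) * (merge_sign \<alpha> (\<delta> - \<alpha>) * z \<alpha> * w (\<delta> - \<alpha>)) * v (\<gamma> - \<delta>))"
    unfolding super_conv_def sum_distrib_left sum_distrib_right
    using fin fs by (subst sum.Sigma) auto
  also have "\<dots> = (\<Sum>(\<alpha>, \<beta>)\<in>Sigma (Pow \<gamma>) (\<lambda>\<alpha>. Pow (\<gamma> - \<alpha>)).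
      merge_sign \<alpha> (\<gamma> - \<alpha>) * z \<alpha> * (merge_sign \<beta> (\<gamma> - \<alpha> - \<beta>) * w \<beta> * v (\<gamma> - \<alpha> - \<beta>)))"
  proof (rule sum.reindex_bij_witness[where
        i = "\<lambda>(\<alpha>, \<beta>). (\<alpha> \<union> \<beta>, \<alpha>)" and j = "\<lambda>(\<delta>, \<alpha>). (\<alpha>, \<delta> - \<alpha>)"])
    fix p assume p: "p \<in> Sigma (Pow \<gamma>) Pow"
    obtain \<delta> \<alpha> where [simp]: "p = (\<delta>, \<alpha>)" by (cases p)
    have *: "\<delta> \<subseteq> \<gamma>" "\<alpha> \<subseteq> \<delta>" using p by auto
    have f: "finite \<alpha>" "finite (\<delta> - \<alpha>)" "finite (\<gamma> - \<delta>)" using * fs by auto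
    have e: "\<gamma> - \<alpha> - (\<delta> - \<alpha>) = \<gamma> - \<delta>" "\<gamma> - \<alpha> = (\<delta> - \<alpha>) \<union> (\<gamma> - \<delta>)" using * by auto
    have "merge_sign \<delta> (\<gamma> - \<delta>) = merge_sign (\<alpha> \<union> (\<delta> - \<alpha>)) (\<gamma> - \<delta>)"
      using * by (simp add: Un_absorb1)
    also have "\<dots> = merge_sign \<alpha> (\<gamma> - \<delta>) * merge_sign (\<delta> - \<alpha>) (\<gamma> - \<delta>)"
      by (rule merge_sign_Un_left) (use f in auto)
    finally have 1: "merge_sign \<delta> (\<gamma> - \<delta>) = \<dots>" .
    have 2: "merge_sign \<alpha> (\<gamma> - \<alpha>) = merge_sign \<alpha> (\<delta> - \<alpha>) * merge_sign \<alpha> (\<gamma> - \<delta>)"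
      unfolding e(2) by (rule merge_sign_Un_right) (use f in auto)
    show "(case (case p of (\<delta>, \<alpha>) \<Rightarrow> (\<alpha>, \<delta> - \<alpha>)) of (\<alpha>, \<beta>) \<Rightarrow>
         merge_sign \<alpha> (\<gamma> - \<alpha>) * z \<alpha> * (merge_sign \<beta> (\<gamma> - \<alpha> - \<beta>) * w \<beta> * v (\<gamma> - \<alpha> - \<beta>))) =
       (case p of (\<delta>, \<alpha>) \<Rightarrow>
         merge_sign \<delta> (\<gamma> - \<delta>) * (merge_sign \<alpha> (\<delta> - \<alpha>) * z \<alpha> * w (\<delta> - \<alpha>)) * v (\<gamma> - \<delta>))"
      unfolding \<open>p = (\<delta>, \<alpha>)\<close> prod.case e(1) 1 2 by (simp only: mult_ac)
  qed auto
  also have "\<dots> = super_conv z (super_conv w v) \<gamma>"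
    unfolding super_conv_def sum_distrib_left sum_distrib_right
    using fin by (subst sum.Sigma) auto
  finally show ?thesis .
qed (simp add: super_conv_infinite)

instantiation supernumber :: ring_1
begin

lift_definition zero_supernumber :: supernumber is "\<lambda>_. 0" by simp

lift_definition one_supernumber :: supernumber is "\<lambda>\<alpha>. if \<alpha> = {} then 1 else 0"
proof -
  have "(\<lambda>\<alpha>. cmod (if \<alpha> = {} then 1 else 0)) summable_on multi_indices \<longleftrightarrow>
        (\<lambda>\<alpha>. cmod (if \<alpha> = {} then 1 else 0)) summable_on {{} :: nat set}"
    by (rule summable_on_cong_neutral) (auto simp: multi_indices_def)
  thus "?thesis" by (simp add: multi_indices_def)
qed

lift_definition plus_supernumber :: "supernumber \<Rightarrow> supernumber \<Rightarrow> supernumber"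
  is "\<lambda>z w \<alpha>. z \<alpha> + w \<alpha>"
  by (auto simp: summable_cmod_add)

lift_definition uminus_supernumber :: "supernumber \<Rightarrow> supernumber"
  is "\<lambda>z \<alpha>. - z \<alpha>" by simp

lift_definition minus_supernumber :: "supernumber \<Rightarrow> supernumber \<Rightarrow> supernumber"
  is "\<lambda>z w \<alpha>. z \<alpha> - w \<alpha>"
  by (auto simp: summable_cmod_diff)

lift_definition times_supernumber :: "supernumber \<Rightarrow> supernumber \<Rightarrow> supernumber"
  is super_conv
proof -
  fix z w :: "nat set \<Rightarrow> complex"
  let ?P = "\<lambda>z. (\<forall>\<alpha>. \<alpha> \<notin> multi_indices \<longrightarrow> z \<alpha> = 0) \<and> (\<lambda>\<alpha>. cmod (z \<alpha>)) summable_on multi_indices"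
  assume "?P z" "?P w"
  hence "z = coef (Supernumber z)" "w = coef (Supernumber w)"
    by (auto simp: Supernumber_inverse)
  thus "?P (super_conv z w)"
    using super_conv_outside[of _ "Supernumber z" "Supernumber w"]
      super_conv_summable[of "Supernumber z" "Supernumber w"] by simp
qed

instance
proof
  fix a b c :: supernumber
  show "a * b * c = a * (b * c)" by transfer (rule ext, rule super_conv_assoc)
  show "1 * a = a"
  proof (rule supernumber_eqI)
    fix \<gamma>
    show "coef (1 * a) \<gamma> = coef a \<gamma>"
    proof (cases "finite \<gamma>")
      case True
      have "coef (1 * a) \<gamma> = (\<Sum>\<alpha>\<in>Pow \<gamma>. if \<alpha> = {} then coef a \<gamma> else 0)"
        unfolding times_supernumber.rep_eq one_supernumber.rep_eq super_conv_def
        by (rule sum.cong) auto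
      thus ?thesis using True by simp
    next
      case False
      thus ?thesis by (simp add: times_supernumber.rep_eq super_conv_infinite coef_outside multi_indices_def)
    qed
  qed
  show "a * 1 = a"
  proof (rule supernumber_eqI)
    fix \<gamma>
    show "coef (a * 1) \<gamma> = coef a \<gamma>"
    proof (cases "finite \<gamma>")
      case True
      have "coef (a * 1) \<gamma> = (\<Sum>\<alpha>\<in>Pow \<gamma>. if \<alpha> = \<gamma> then coef a \<gamma> else 0)"
        unfolding times_supernumber.rep_eq one_supernumber.rep_eq super_conv_def
        by (rule sum.cong) auto
      thus ?thesis using True by simp
    next
      case False
      thus ?thesis by (simp add: times_supernumber.rep_eq super_conv_infinite coef_outside multi_indices_def)
    qed
  qed
  show "(a + b) * c = a * c + b * c"
    by (rule supernumber_eqI)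
      (simp add: times_supernumber.rep_eq plus_supernumber.rep_eq super_conv_def
        algebra_simps sum.distrib)
  show "a * (b + c) = a * b + a * c"
    by (rule supernumber_eqI)
      (simp add: times_supernumber.rep_eq plus_supernumber.rep_eq super_conv_def
        algebra_simps sum.distrib)
  show "(0::supernumber) \<noteq> 1" by transfer (auto simp: fun_eq_iff)
qed (transfer; simp add: fun_eq_iff)+

end

instantiation supernumber :: real_normed_algebra_1
begin

lift_definition scaleR_supernumber :: "real \<Rightarrow> supernumber \<Rightarrow> supernumber"
  is "\<lambda>r z \<alpha>. of_real r * z \<alpha>" by (simp add: norm_mult summable_on_cmult_right)

lift_definition norm_supernumber :: "supernumber \<Rightarrow> real"
  is "\<lambda>z. infsum (\<lambda>\<alpha>. cmod (z \<alpha>)) multi_indices" .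

definition dist_supernumber :: "supernumber \<Rightarrow> supernumber \<Rightarrow> real" where
  "dist_supernumber z w = norm (z - w)"

definition sgn_supernumber :: "supernumber \<Rightarrow> supernumber" where
  "sgn_supernumber z = inverse (norm z) *\<^sub>R z"

definition uniformity_supernumber :: "(supernumber \<times> supernumber) filter" where
  "uniformity_supernumber = (INF e\<in>{0<..}. principal {(x, y). dist x y < e})"

definition open_supernumber :: "supernumber set \<Rightarrow> bool" where
  "open_supernumber U \<longleftrightarrow> (\<forall>x\<in>U. eventually (\<lambda>(x', y). x' = x \<longrightarrow> y \<in> U) uniformity)"

instance
proof
  fix a b c :: supernumber and r s :: real and U :: "supernumber set"
  show "dist a b = norm (a - b)" "sgn a = inverse (norm a) *\<^sub>R a"
    "uniformity = (INF e\<in>{0<..}. principal {(x, y). dist x (y::supernumber) < e})"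
    "open U \<longleftrightarrow> (\<forall>x\<in>U. eventually (\<lambda>(x', y). x' = x \<longrightarrow> y \<in> U) uniformity)"
    by (simp_all only: dist_supernumber_def sgn_supernumber_def uniformity_supernumber_def
        open_supernumber_def)
  show "r *\<^sub>R (a + b) = r *\<^sub>R a + r *\<^sub>R b" "(r + s) *\<^sub>R a = r *\<^sub>R a + s *\<^sub>R a"
    "r *\<^sub>R s *\<^sub>R a = (r * s) *\<^sub>R a" "1 *\<^sub>R a = a"
    by (transfer; simp add: fun_eq_iff algebra_simps)+
  show "r *\<^sub>R a * b = r *\<^sub>R (a * b)" "a * r *\<^sub>R b = r *\<^sub>R (a * b)"
    by (rule supernumber_eqI, simp add: times_supernumber.rep_eq scaleR_supernumber.rep_eq
        super_conv_def sum_distrib_left mult_ac)+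
  show "(norm a = 0) = (a = 0)"
  proof
    assume "norm a = 0"
    hence *: "infsum (\<lambda>\<alpha>. cmod (coef a \<alpha>)) multi_indices = 0"
      by (simp add: norm_supernumber.rep_eq)
    have "coef a \<alpha> = 0" for \<alpha>
    proof (cases "\<alpha> \<in> multi_indices")
      case True
      have "sum (\<lambda>\<alpha>. cmod (coef a \<alpha>)) {\<alpha>} \<le> infsum (\<lambda>\<alpha>. cmod (coef a \<alpha>)) multi_indices"
        using True by (intro finite_sum_le_infsum coef_summable) auto
      thus ?thesis using * by simp
    qed (simp add: coef_outside)
    thus "a = 0" by (intro supernumber_eqI) (simp add: zero_supernumber.rep_eq)
  qed (simp add: norm_supernumber.rep_eq zero_supernumber.rep_eq)
  show "norm (a + b) \<le> norm a + norm b"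
    unfolding norm_supernumber.rep_eq plus_supernumber.rep_eq
    by (subst infsum_add[OF coef_summable coef_summable, symmetric],
        intro infsum_mono summable_cmod_add summable_on_add coef_summable norm_triangle_ineq)
  show "norm (r *\<^sub>R a) = \<bar>r\<bar> * norm a"
    unfolding norm_supernumber.rep_eq scaleR_supernumber.rep_eq
    by (simp add: norm_mult infsum_cmult_right')
  show "norm (a * b) \<le> norm a * norm b"
    unfolding norm_supernumber.rep_eq times_supernumber.rep_eq
    by (rule infsum_le_finite_sums[OF super_conv_summable]) (rule super_conv_sum_bound)
  have "infsum (\<lambda>\<alpha>. cmod (if \<alpha> = {} then 1 else 0)) multi_indices =
        infsum (\<lambda>\<alpha>. cmod (if \<alpha> = {} then 1 else 0)) {{} :: nat set}"
    by (rule infsum_cong_neutral) (auto simp: multi_indices_def)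
  thus "norm (1 :: supernumber) = 1"
    by (simp add: norm_supernumber.rep_eq one_supernumber.rep_eq)
qed

end

text \<open>The basis element \<open>i\<^sub>\<alpha>\<close>; the two lemmas that follow confirm that the one-element indices
  give anticommuting generators and that \<open>i\<^sub>\<alpha>\<close> is the product of the generators in increasing order.\<close>

lift_definition super_basis :: "nat set \<Rightarrow> supernumber"
  is "\<lambda>\<alpha> \<gamma>. if \<alpha> \<in> multi_indices \<and> \<gamma> = \<alpha> then 1 else 0"
proof -
  fix \<alpha> :: "nat set"
  let ?f = "\<lambda>\<gamma>. if \<alpha> \<in> multi_indices \<and> \<gamma> = \<alpha> then 1 else (0::complex)"
  have "(\<lambda>\<gamma>. cmod (?f \<gamma>)) summable_on multi_indices \<longleftrightarrow>
        (\<lambda>\<gamma>. cmod (?f \<gamma>)) summable_on ({\<alpha>} \<inter> multi_indices)"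
    by (rule summable_on_cong_neutral) auto
  thus "?thesis \<alpha>" by auto
qed

lemma coef_super_basis_mult:
  assumes "\<alpha> \<in> multi_indices" "\<beta> \<in> multi_indices"
  shows "coef (super_basis \<alpha> * super_basis \<beta>) \<gamma> =
    (if \<alpha> \<inter> \<beta> = {} \<and> \<gamma> = \<alpha> \<union> \<beta> then merge_sign \<alpha> \<beta> else 0)"
proof (cases "finite \<gamma>")
  case True
  have "coef (super_basis \<alpha> * super_basis \<beta>) \<gamma> =
      (\<Sum>\<delta>\<in>Pow \<gamma>. if \<delta> = \<alpha> then (if \<gamma> - \<alpha> = \<beta> then merge_sign \<alpha> \<beta> else 0) else 0)"
    unfolding times_supernumber.rep_eq super_basis.rep_eq super_conv_def
    by (rule sum.cong) (use assms in auto)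
  also have "\<dots> = (if \<alpha> \<subseteq> \<gamma> \<and> \<gamma> - \<alpha> = \<beta> then merge_sign \<alpha> \<beta> else 0)"
    using True by simp
  also have "\<alpha> \<subseteq> \<gamma> \<and> \<gamma> - \<alpha> = \<beta> \<longleftrightarrow> \<alpha> \<inter> \<beta> = {} \<and> \<gamma> = \<alpha> \<union> \<beta>" by auto
  finally show ?thesis .
next
  case False
  hence "\<gamma> \<noteq> \<alpha> \<union> \<beta>" using assms by (auto simp: multi_indices_def)
  thus ?thesis using False by (simp add: times_supernumber.rep_eq super_conv_infinite)
qed

lemma generators_anticommute:
  assumes "n > 0" "m > 0"
  shows "super_basis {n} * super_basis {m} + super_basis {m} * super_basis {n} = 0"
proof -
  have *: "merge_sign {n} {m} + merge_sign {m} {n} = 0" if "n \<noteq> m"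
  proof -
    have "{(a, b). a \<in> {n} \<and> b \<in> {m} \<and> b < a} = (if m < n then {(n, m)} else {})"
      "{(a, b). a \<in> {m} \<and> b \<in> {n} \<and> b < a} = (if n < m then {(m, n)} else {})" by auto
    thus ?thesis using that by (auto simp: merge_sign_def)
  qed
  have mi: "{n} \<in> multi_indices" "{m} \<in> multi_indices" using assms by (auto simp: multi_indices_def)
  show ?thesis
    by (rule supernumber_eqI)
      (use * in \<open>auto simp: plus_supernumber.rep_eq zero_supernumber.rep_eq
        coef_super_basis_mult[OF mi] coef_super_basis_mult[OF mi(2,1)]\<close>)
qed

lemma super_basis_insert_greatest:
  assumes "\<alpha> \<in> multi_indices" "b > 0" "\<And>a. a \<in> \<alpha> \<Longrightarrow> a < b"
  shows "super_basis (insert b \<alpha>) = super_basis \<alpha> * super_basis {b}"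
proof -
  have mi: "{b} \<in> multi_indices" "insert b \<alpha> \<in> multi_indices"
    using assms by (auto simp: multi_indices_def)
  have "{(a, c). a \<in> \<alpha> \<and> c \<in> {b} \<and> c < a} = {}" using assms(3) by fastforce
  hence "merge_sign \<alpha> {b} = 1" unfolding merge_sign_def by (simp only: card.empty power_0)
  moreover have "b \<notin> \<alpha>" using assms(3) by blast
  ultimately show ?thesis
    by (intro supernumber_eqI)
      (auto simp: coef_super_basis_mult[OF assms(1) mi(1)] super_basis.rep_eq mi)
qed

definition body :: "supernumber \<Rightarrow> complex" where
  "body z = coef z {}"

lift_definition dagger :: "supernumber \<Rightarrow> supernumber" (\<open>_\<^sup>\<dagger>\<close> [1000] 999)
  is "\<lambda>z \<alpha>. (-1) ^ (card \<alpha> * (card \<alpha> - 1) div 2) * cnj (z \<alpha>)"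
  by (simp add: norm_mult norm_power)

definition super_invertible :: "supernumber \<Rightarrow> bool" where
  "super_invertible z \<longleftrightarrow> (\<exists>w. z * w = 1 \<and> w * z = 1)"

definition superpos :: "supernumber \<Rightarrow> bool" where
  "superpos z \<longleftrightarrow> super_invertible z \<and> (\<exists>w. z = w * w\<^sup>\<dagger>)"


section \<open>Matrices of supernumbers\<close>

definition super_adjoint :: "supernumber mat \<Rightarrow> supernumber mat" (\<open>_\<^sup>\<star>\<close> [1000] 999) where
  "M\<^sup>\<star> = map_mat dagger (transpose_mat M)"

abbreviation body_mat :: "supernumber mat \<Rightarrow> complex mat" where
  "body_mat \<equiv> map_mat body"

text \<open>The \<open>1 \<times> 1\<close> matrix \<open>c\<^sup>\<star> M c\<close> is identified with its only entry.\<close>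

definition superpositive :: "supernumber mat \<Rightarrow> bool" where
  "superpositive M \<longleftrightarrow> square_mat M \<and>
    (\<forall>c \<in> carrier_mat (dim_row M) 1. body_mat c \<noteq> 0\<^sub>m (dim_row M) 1 \<longrightarrow>
      superpos ((c\<^sup>\<star> * M * c) $$ (0, 0)))"

text \<open>In the order on \<open>complex\<close>, \<open>0 < x\<close> means that \<open>x\<close> is real and positive;
  \<open>(A *\<^sub>v v) \<bullet>c v\<close> is the quadratic form of \<open>A\<close> at \<open>v\<close>.\<close>

definition positive_definite :: "complex mat \<Rightarrow> bool" where
  "positive_definite A \<longleftrightarrow> square_mat A \<and>
    (\<forall>v \<in> carrier_vec (dim_row A). v \<noteq> 0\<^sub>v (dim_row A) \<longrightarrow> 0 < (A *\<^sub>v v) \<bullet>c v)"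

definition lower_triangular :: "'a::zero mat \<Rightarrow> bool" where
  "lower_triangular A \<longleftrightarrow> (\<forall>j < dim_col A. \<forall>i < j. i < dim_row A \<longrightarrow> A $$ (i, j) = 0)"

definition unit_diagonal :: "'a::{zero,one} mat \<Rightarrow> bool" where
  "unit_diagonal A \<longleftrightarrow> (\<forall>i < dim_row A. A $$ (i, i) = 1)"

definition superpos_diagonal :: "supernumber mat \<Rightarrow> bool" where
  "superpos_diagonal A \<longleftrightarrow> (\<forall>i < dim_row A. superpos (A $$ (i, i)))"

text \<open>A Cholesky factorisation \<open>M = L L\<^sup>\<star>\<close> cannot be required to have ones on the diagonal of
  \<open>L\<close>: the \<open>1 \<times> 1\<close> matrix \<open>(2)\<close> is self-adjoint with positive definite body, but \<open>1 \<cdot> 1\<^sup>\<dagger> \<noteq> 2\<close>.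
  The factors are therefore asked to have positive diagonal entries; ones are a special case.\<close>

lemma dagger_one: "1\<^sup>\<dagger> = 1"
  by (rule supernumber_eqI) (simp add: dagger.rep_eq one_supernumber.rep_eq)

lemma superpos_one: "superpos 1"
  unfolding superpos_def super_invertible_def by (metis dagger_one mult_1_right)

lemma unit_diagonal_imp_superpos_diagonal: "unit_diagonal A \<Longrightarrow> superpos_diagonal A"
  by (simp add: unit_diagonal_def superpos_diagonal_def superpos_one)

lemma no_unit_diagonal_Cholesky:
  defines "M \<equiv> mat 1 1 (\<lambda>_. 2 :: supernumber)"
  shows "M\<^sup>\<star> = M" "positive_definite (body_mat M)"
    "\<nexists>L. L \<in> carrier_mat 1 1 \<and> unit_diagonal L \<and> M = L * L\<^sup>\<star>"
proof -
  have two: "coef 2 = (\<lambda>\<alpha>. if \<alpha> = {} then 2 else 0)"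
    unfolding one_add_one[symmetric] plus_supernumber.rep_eq one_supernumber.rep_eq by auto
  have "2\<^sup>\<dagger> = 2" by (rule supernumber_eqI) (simp add: dagger.rep_eq two)
  thus "M\<^sup>\<star> = M" by (auto simp: M_def super_adjoint_def)
  show "positive_definite (body_mat M)"
    unfolding positive_definite_def
  proof (intro conjI ballI impI)
    fix v :: "complex Matrix.vec"
    assume v: "v \<in> carrier_vec (dim_row (body_mat M))" "v \<noteq> 0\<^sub>v (dim_row (body_mat M))"
    hence dim: "dim_vec v = 1" by (simp add: M_def)
    have "v $ 0 \<noteq> 0" using v dim by (auto simp: M_def)
    moreover have "(body_mat M *\<^sub>v v) \<bullet>c v = 2 * (v $ 0 * cnj (v $ 0))"
      using dim by (simp add: M_def scalar_prod_def body_def two)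
    ultimately show "0 < (body_mat M *\<^sub>v v) \<bullet>c v"
      by (simp add: complex_norm_square[symmetric] less_complex_def)
  qed (simp add: M_def)
  show "\<nexists>L. L \<in> carrier_mat 1 1 \<and> unit_diagonal L \<and> M = L * L\<^sup>\<star>"
  proof
    assume "\<exists>L. L \<in> carrier_mat 1 1 \<and> unit_diagonal L \<and> M = L * L\<^sup>\<star>"
    then obtain L where L: "L \<in> carrier_mat 1 1" "L $$ (0, 0) = 1" "M = L * L\<^sup>\<star>"
      by (auto simp: unit_diagonal_def)
    have "M $$ (0, 0) = L $$ (0, 0) * (L $$ (0, 0))\<^sup>\<dagger>"
      unfolding L(3) using L(1) by (simp add: super_adjoint_def scalar_prod_def)
    hence "(2 :: supernumber) = 1" by (simp add: L(2) dagger_one M_def)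
    thus False by simp
  qed
qed

end

(* An element with body 0 has arbitrarily small norm after an automorphism that scales finitely
   many generators. Contraction arguments in the Banach algebra therefore give inverses of the
   elements with positive body, and self-adjoint square roots of those that are self-adjoint, so
   that z is positive iff it is self-adjoint with positive body. Polarization then identifies the
   superpositive matrices, and successive Schur complements, whose pivots are positive and hence
   have inverses and square roots, give the factorisations; the upper triangular one is obtained
   by reversing the order of the indices. *)

theory Submission
  imports Defs "HOL-Analysis.Elementary_Metric_Spaces"
begin

section \<open>The body and the conjugation\<close>

text \<open>With infinitely many generators an element of body 0 need not be nilpotent, and its norm
  may be large, so neither a finite expansion nor a direct contraction is available. Scaling every
  generator by a small factor would shrink it, but the inverse scaling is unbounded. Scaling only
  finitely many generators is invertible, and it suffices because finitely many indices carry all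
  but an arbitrarily small part of the norm. Matrices are treated as functions of two indices, so
  that dropping the first row and column, or reversing the order, is a substitution of indices.
  Supernumbers do not commute, so the inverse of a pivot has to stay between its column and its
  row.\<close>

lemmas coef_simps = zero_supernumber.rep_eq one_supernumber.rep_eq plus_supernumber.rep_eq
  uminus_supernumber.rep_eq minus_supernumber.rep_eq times_supernumber.rep_eq
  scaleR_supernumber.rep_eq dagger.rep_eq

lemma body_simps [simp]:
  "body 0 = 0" "body 1 = 1" "body (z + w) = body z + body w" "body (- z) = - body z"
  "body (z - w) = body z - body w" "body (z * w) = body z * body w"
  "body (r *\<^sub>R z) = of_real r * body z" "body (z\<^sup>\<dagger>) = cnj (body z)"
  by (simp_all add: body_def coef_simps super_conv_def)

lemma body_sum: "body (\<Sum>x\<in>A. f x) = (\<Sum>x\<in>A. body (f x))"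
  by (induction A rule: infinite_finite_induct) auto

text \<open>\<open>m * (m - 1) div 2\<close> is the number of transpositions that reverse a word of
  \<open>m\<close> generators. A word of length \<open>m + n\<close> is reversed by reversing its
  two blocks and exchanging them, at the price of \<open>m * n\<close> further
  transpositions.\<close>

lemma triangular_sign_add:
  "(-1) ^ ((m + n) * (m + n - 1) div 2) =
    ((-1) ^ (m * (m - 1) div 2) * (-1) ^ (n * (n - 1) div 2) * (-1) ^ (m * n) :: complex)"
proof -
  have even: "even (k * (k - 1))" for k :: nat by (cases k) auto
  have "(m + n) * (m + n - 1) = m * (m - 1) + n * (n - 1) + 2 * (m * n)"
    by (cases m; cases n) (auto simp: algebra_simps)
  hence "(m + n) * (m + n - 1) div 2 = m * (m - 1) div 2 + n * (n - 1) div 2 + m * n"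
    using even[of m] even[of n] by (metis div_plus_div_distrib_dvd_left dvd_add dvd_triv_left
        nonzero_mult_div_cancel_left zero_neq_numeral)
  thus ?thesis by (simp add: power_add)
qed

text \<open>Each pair in \<open>\<alpha> \<times> \<beta>\<close> is out of order for exactly one of
  the two orders of the factors, so the two inversion counts add up to
  \<open>card \<alpha> * card \<beta>\<close>.\<close>

lemma merge_sign_swap:
  assumes "finite \<alpha>" "finite \<beta>" "\<alpha> \<inter> \<beta> = {}"
  shows "merge_sign \<beta> \<alpha> = (-1) ^ (card \<alpha> * card \<beta>) * merge_sign \<alpha> \<beta>"
proof -
  let ?A = "{(a, b). a \<in> \<alpha> \<and> b \<in> \<beta> \<and> b < a}" and ?B = "{(b, a). b \<in> \<beta> \<and> a \<in> \<alpha> \<and> a < b}"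
  have split: "\<alpha> \<times> \<beta> = ?A \<union> prod.swap ` ?B" "?A \<inter> prod.swap ` ?B = {}"
    using assms(3) by (auto simp: image_iff)
  have "card \<alpha> * card \<beta> = card (\<alpha> \<times> \<beta>)" by (simp add: card_cartesian_product)
  also have "\<dots> = card ?A + card (prod.swap ` ?B)"
    by (subst split(1), rule card_Un_disjoint) (use assms finite_inversions split(2) in auto)
  also have "card (prod.swap ` ?B) = card ?B"
    by (rule card_image) (auto simp: inj_on_def)
  finally show ?thesis
    by (simp add: merge_sign_def power_add flip: power_mult_distrib)
qed

lemma dagger_mult: "(z * w)\<^sup>\<dagger> = w\<^sup>\<dagger> * z\<^sup>\<dagger>"
proof (rule supernumber_eqI)
  fix \<gamma>
  define s where "s = (\<lambda>\<alpha> :: nat set. (-1) ^ (card \<alpha> * (card \<alpha> - 1) div 2) :: complex)"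
  show "coef ((z * w)\<^sup>\<dagger>) \<gamma> = coef (w\<^sup>\<dagger> * z\<^sup>\<dagger>) \<gamma>"
  proof (cases "finite \<gamma>")
    case True
    have cnj_sign: "cnj (merge_sign \<alpha> \<beta>) = merge_sign \<alpha> \<beta>" for \<alpha> \<beta>
      by (simp add: merge_sign_def)
    have sign: "s \<gamma> * merge_sign \<alpha> (\<gamma> - \<alpha>) = merge_sign (\<gamma> - \<alpha>) \<alpha> * s \<alpha> * s (\<gamma> - \<alpha>)"
      if "\<alpha> \<subseteq> \<gamma>" for \<alpha>
    proof -
      have fin: "finite \<alpha>" "finite (\<gamma> - \<alpha>)" using True that finite_subset by auto
      have "card \<gamma> = card \<alpha> + card (\<gamma> - \<alpha>)"
        using card_Un_disjoint[OF fin] that by (simp add: Un_absorb1)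
      moreover have "merge_sign (\<gamma> - \<alpha>) \<alpha> =
          (-1) ^ (card \<alpha> * card (\<gamma> - \<alpha>)) * merge_sign \<alpha> (\<gamma> - \<alpha>)"
        by (rule merge_sign_swap) (use fin in auto)
      ultimately show ?thesis by (simp only: s_def triangular_sign_add mult_ac)
    qed
    have "coef ((z * w)\<^sup>\<dagger>) \<gamma> =
        (\<Sum>\<alpha>\<in>Pow \<gamma>. (s \<gamma> * merge_sign \<alpha> (\<gamma> - \<alpha>)) * cnj (coef z \<alpha>) * cnj (coef w (\<gamma> - \<alpha>)))"
      by (simp add: s_def coef_simps super_conv_def sum_distrib_left cnj_sign mult.assoc)
    also have "\<dots> = (\<Sum>\<alpha>\<in>Pow \<gamma>. merge_sign (\<gamma> - \<alpha>) \<alpha> * (s (\<gamma> - \<alpha>) * cnj (coef w (\<gamma> - \<alpha>)))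
        * (s \<alpha> * cnj (coef z \<alpha>)))"
      by (rule sum.cong) (auto simp: sign mult_ac)
    \<comment> \<open>Passing to complements in \<open>\<gamma>\<close> exchanges the roles of the
      two factors.\<close>
    also have "\<dots> = (\<Sum>\<alpha>\<in>Pow \<gamma>. merge_sign \<alpha> (\<gamma> - \<alpha>) * (s \<alpha> * cnj (coef w \<alpha>))
        * (s (\<gamma> - \<alpha>) * cnj (coef z (\<gamma> - \<alpha>))))"
      by (rule sum.reindex_bij_witness[of _ "\<lambda>\<alpha>. \<gamma> - \<alpha>" "\<lambda>\<alpha>. \<gamma> - \<alpha>"])
        (auto simp: double_diff)
    also have "\<dots> = coef (w\<^sup>\<dagger> * z\<^sup>\<dagger>) \<gamma>"
      by (simp add: s_def coef_simps super_conv_def)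
    finally show ?thesis .
  qed (simp add: coef_simps super_conv_infinite)
qed

lemma dagger_simps [simp]:
  "0\<^sup>\<dagger> = 0" "1\<^sup>\<dagger> = 1" "(z + w)\<^sup>\<dagger> = z\<^sup>\<dagger> + w\<^sup>\<dagger>" "(- z)\<^sup>\<dagger> = - z\<^sup>\<dagger>" "(z - w)\<^sup>\<dagger> = z\<^sup>\<dagger> - w\<^sup>\<dagger>"
  "(z * w)\<^sup>\<dagger> = w\<^sup>\<dagger> * z\<^sup>\<dagger>" "(r *\<^sub>R z)\<^sup>\<dagger> = r *\<^sub>R z\<^sup>\<dagger>" "(z\<^sup>\<dagger>)\<^sup>\<dagger> = z"
  by (simp_all add: dagger_mult dagger_one)
    (rule supernumber_eqI, simp add: coef_simps algebra_simps flip: power_mult_distrib)+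

lemma dagger_sum: "(\<Sum>x\<in>A. f x)\<^sup>\<dagger> = (\<Sum>x\<in>A. (f x)\<^sup>\<dagger>)"
  by (induction A rule: infinite_finite_induct) auto

lemma norm_dagger [simp]: "norm (z\<^sup>\<dagger>) = norm z"
  by (simp add: norm_supernumber.rep_eq dagger.rep_eq norm_mult norm_power)

section \<open>Completeness\<close>

text \<open>Bounds on finite partial sums survive coefficientwise limits and allow a finite set of
  indices to be split off.\<close>

lemma norm_supernumber_le_iff:
  "norm z \<le> B \<longleftrightarrow> (\<forall>F. finite F \<and> F \<subseteq> multi_indices \<longrightarrow> (\<Sum>\<alpha>\<in>F. cmod (coef z \<alpha>)) \<le> B)"
proof
  assume "norm z \<le> B"
  thus "\<forall>F. finite F \<and> F \<subseteq> multi_indices \<longrightarrow> (\<Sum>\<alpha>\<in>F. cmod (coef z \<alpha>)) \<le> B"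
    unfolding norm_supernumber.rep_eq
    using finite_sum_le_infsum[OF coef_summable, of _ z] by (auto intro: order.trans)
next
  assume "\<forall>F. finite F \<and> F \<subseteq> multi_indices \<longrightarrow> (\<Sum>\<alpha>\<in>F. cmod (coef z \<alpha>)) \<le> B"
  thus "norm z \<le> B"
    unfolding norm_supernumber.rep_eq by (intro infsum_le_finite_sums coef_summable) blast
qed

lemma coef_le_norm: "cmod (coef z \<alpha>) \<le> norm z"
proof (cases "\<alpha> \<in> multi_indices")
  case True
  hence "(\<Sum>\<alpha>\<in>{\<alpha>}. cmod (coef z \<alpha>)) \<le> norm z"
    using norm_supernumber_le_iff[of z "norm z"] by (metis empty_subsetI finite.simps insert_subset order_refl)
  thus ?thesis by simp
qed (simp add: coef_outside)

text \<open>The coefficientwise limit is the candidate, and bounds on finite partial sums pass to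
  it. Completeness is what both fixed point arguments rest on.\<close>

instance supernumber :: banach
proof
  fix X :: "nat \<Rightarrow> supernumber"
  assume "Cauchy X"
  have "Cauchy (\<lambda>n. coef (X n) \<alpha>)" for \<alpha>
  proof (rule metric_CauchyI)
    fix e :: real assume "e > 0"
    then obtain N where N: "\<And>m n. m \<ge> N \<Longrightarrow> n \<ge> N \<Longrightarrow> norm (X m - X n) < e"
      using \<open>Cauchy X\<close> unfolding Cauchy_def dist_norm by blast
    show "\<exists>N. \<forall>m\<ge>N. \<forall>n\<ge>N. dist (coef (X m) \<alpha>) (coef (X n) \<alpha>) < e"
      using N coef_le_norm[of "X _ - X _" \<alpha>]
      by (metis dist_norm le_less_trans minus_supernumber.rep_eq)
  qed
  hence "\<exists>l. (\<lambda>n. coef (X n) \<alpha>) \<longlonglongrightarrow> l" for \<alpha>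
    using Cauchy_convergent unfolding convergent_def by blast
  then obtain z where z: "\<And>\<alpha>. (\<lambda>n. coef (X n) \<alpha>) \<longlonglongrightarrow> z \<alpha>" by metis
  \<comment> \<open>Stated for a general \<open>w\<close> because it serves twice:
    \<open>w = 0\<close> makes the limit summable, \<open>w = X n\<close> gives convergence in
    norm.\<close>
  have sum_le: "(\<Sum>\<alpha>\<in>F. cmod (z \<alpha> - coef w \<alpha>)) \<le> B"
    if F: "finite F" "F \<subseteq> multi_indices" and B: "\<forall>\<^sub>F n in sequentially. norm (X n - w) \<le> B" for F w B
  proof (rule tendsto_upperbound)
    show "(\<lambda>n. \<Sum>\<alpha>\<in>F. cmod (coef (X n) \<alpha> - coef w \<alpha>)) \<longlonglongrightarrow> (\<Sum>\<alpha>\<in>F. cmod (z \<alpha> - coef w \<alpha>))"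
      by (intro tendsto_intros z)
    show "\<forall>\<^sub>F n in sequentially. (\<Sum>\<alpha>\<in>F. cmod (coef (X n) \<alpha> - coef w \<alpha>)) \<le> B"
      using B by (rule eventually_mono)
        (use F in \<open>simp add: norm_supernumber_le_iff minus_supernumber.rep_eq\<close>)
  qed simp
  obtain B where B: "\<And>n. norm (X n) \<le> B"
    using Cauchy_Bseq[OF \<open>Cauchy X\<close>] unfolding Bseq_def by blast
  have "(\<lambda>\<alpha>. cmod (z \<alpha>)) summable_on multi_indices"
  proof (rule nonneg_bdd_above_summable_on)
    show "bdd_above (sum (\<lambda>\<alpha>. cmod (z \<alpha>)) ` {F. F \<subseteq> multi_indices \<and> finite F})"
      using sum_le[of _ 0 B] B
      by (intro bdd_aboveI2[where M = B]) (auto simp: zero_supernumber.rep_eq)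
  qed simp
  moreover have "z \<alpha> = 0" if "\<alpha> \<notin> multi_indices" for \<alpha>
    using z[of \<alpha>] that by (simp add: coef_outside LIMSEQ_const_iff)
  ultimately have coef_z: "coef (Supernumber z) = z"
    by (simp add: Supernumber_inverse)
  have "X \<longlonglongrightarrow> Supernumber z"
  proof (rule LIMSEQ_I)
    fix e :: real assume "e > 0"
    then obtain N where N: "\<And>m n. m \<ge> N \<Longrightarrow> n \<ge> N \<Longrightarrow> norm (X m - X n) < e / 2"
      using \<open>Cauchy X\<close> unfolding Cauchy_def dist_norm by (meson half_gt_zero)
    have "norm (X n - Supernumber z) < e" if "n \<ge> N" for n
    proof -
      have "\<forall>\<^sub>F m in sequentially. norm (X m - X n) \<le> e / 2"
        unfolding eventually_sequentially using N that by (meson less_imp_le)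
      hence "norm (Supernumber z - X n) \<le> e / 2"
        unfolding norm_supernumber_le_iff[of "Supernumber z - X n"] minus_supernumber.rep_eq coef_z
        using sum_le by blast
      thus ?thesis using \<open>e > 0\<close> by (simp add: norm_minus_commute)
    qed
    thus "\<exists>N. \<forall>n\<ge>N. norm (X n - Supernumber z) < e" by blast
  qed
  thus "convergent X" unfolding convergent_def by blast
qed

section \<open>Square roots and inverses\<close>

text \<open>The automorphism that scales the generators \<open>i\<^sub>a\<close> with \<open>a < N\<close> by \<open>r\<close>.\<close>

lift_definition dilate :: "nat \<Rightarrow> real \<Rightarrow> supernumber \<Rightarrow> supernumber"
  is "\<lambda>N r z \<alpha>. of_real (r ^ card (\<alpha> \<inter> {..<N})) * z \<alpha>"
proof (intro conjI allI impI)
  fix N :: nat and r :: real and z :: "nat set \<Rightarrow> complex"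
  assume z: "(\<forall>\<alpha>. \<alpha> \<notin> multi_indices \<longrightarrow> z \<alpha> = 0) \<and> (\<lambda>\<alpha>. cmod (z \<alpha>)) summable_on multi_indices"
  show "(\<lambda>\<alpha>. cmod (of_real (r ^ card (\<alpha> \<inter> {..<N})) * z \<alpha>)) summable_on multi_indices"
  proof (rule summable_on_comparison_test)
    \<comment> \<open>At most \<open>N\<close> generators of an index are scaled, which bounds all
      the weights by this constant.\<close>
    show "(\<lambda>\<alpha>. max 1 \<bar>r\<bar> ^ N * cmod (z \<alpha>)) summable_on multi_indices"
      using z by (intro summable_on_cmult_right) auto
    show "cmod (of_real (r ^ card (\<alpha> \<inter> {..<N})) * z \<alpha>) \<le> max 1 \<bar>r\<bar> ^ N * cmod (z \<alpha>)" for \<alpha>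
    proof -
      have "card (\<alpha> \<inter> {..<N}) \<le> N"
        using card_mono[of "{..<N}" "\<alpha> \<inter> {..<N}"] by simp
      hence "max 1 \<bar>r\<bar> ^ card (\<alpha> \<inter> {..<N}) \<le> max 1 \<bar>r\<bar> ^ N"
        by (intro power_increasing) auto
      moreover have "\<bar>r\<bar> ^ card (\<alpha> \<inter> {..<N}) \<le> max 1 \<bar>r\<bar> ^ card (\<alpha> \<inter> {..<N})"
        by (intro power_mono) auto
      ultimately show ?thesis
        by (simp add: norm_mult norm_power mult_right_mono)
    qed
  qed simp
next
  fix N :: nat and r :: real and z :: "nat set \<Rightarrow> complex" and \<alpha> :: "nat set"
  assume "(\<forall>\<alpha>. \<alpha> \<notin> multi_indices \<longrightarrow> z \<alpha> = 0) \<and> (\<lambda>\<alpha>. cmod (z \<alpha>)) summable_on multi_indices"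
    and "\<alpha> \<notin> multi_indices"
  thus "of_real (r ^ card (\<alpha> \<inter> {..<N})) * z \<alpha> = 0" by simp
qed

text \<open>The weight \<open>r ^ card (\<alpha> \<inter> {..<N})\<close> is multiplicative over
  disjoint unions, and only complementary parts of \<open>\<gamma>\<close> are paired in a
  product.\<close>

lemma dilate_mult: "dilate N r (z * w) = dilate N r z * dilate N r w"
proof (rule supernumber_eqI)
  fix \<gamma>
  have "card (\<gamma> \<inter> {..<N}) = card (\<alpha> \<inter> {..<N}) + card ((\<gamma> - \<alpha>) \<inter> {..<N})" if "\<alpha> \<subseteq> \<gamma>" for \<alpha>
  proof -
    have "\<gamma> \<inter> {..<N} = (\<alpha> \<inter> {..<N}) \<union> ((\<gamma> - \<alpha>) \<inter> {..<N})" using that by auto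
    thus ?thesis by (simp only: card_Un_disjoint finite_Int finite_lessThan) (subst card_Un_disjoint; auto)
  qed
  thus "coef (dilate N r (z * w)) \<gamma> = coef (dilate N r z * dilate N r w) \<gamma>"
    by (auto simp: coef_simps dilate.rep_eq super_conv_def sum_distrib_left power_add mult_ac
        intro!: sum.cong)
qed

lemma dilate_simps [simp]:
  "dilate N r 1 = 1" "dilate N r (z + w) = dilate N r z + dilate N r w"
  "dilate N r (z * w) = dilate N r z * dilate N r w" "dilate N r (z\<^sup>\<dagger>) = (dilate N r z)\<^sup>\<dagger>"
  by (simp_all add: dilate_mult)
    (rule supernumber_eqI, simp add: coef_simps dilate.rep_eq algebra_simps)+

lemma dilate_inverse [simp]: "r \<noteq> 0 \<Longrightarrow> dilate N (inverse r) (dilate N r z) = z"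
  by (rule supernumber_eqI) (simp add: dilate.rep_eq field_simps)

text \<open>A finite set \<open>F\<close> of indices carries the norm up to \<open>e / 2\<close>. If
  \<open>N\<close> exceeds all their entries, every nonempty index in \<open>F\<close> gains at
  least one factor \<open>r\<close>.\<close>

lemma dilate_small:
  assumes "body n = 0" "e > 0"
  obtains N r where "r \<noteq> 0" "norm (dilate N r n) \<le> e"
proof -
  have "\<not> norm n \<le> norm n - e / 2" using assms(2) by simp
  then obtain F where F: "finite F" "F \<subseteq> multi_indices" "(\<Sum>\<alpha>\<in>F. cmod (coef n \<alpha>)) > norm n - e / 2"
    unfolding norm_supernumber_le_iff[of _ "norm n - e / 2"] by (meson not_le)
  have "finite (\<Union>F)" using F by (auto simp: multi_indices_def)
  then obtain N where N: "\<Union>F \<subseteq> {..<N}" using finite_nat_bounded by blast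
  \<comment> \<open>Chosen so that \<open>r * (norm n + 1) \<le> e / 2\<close>. The summand 1 keeps
    the denominator positive, and the minimum with 1 keeps the coefficients outside \<open>F\<close>
    from growing.\<close>
  define q where "q = e / 2 / (norm n + 1)"
  define r where "r = min 1 q"
  have "norm n + 1 > 0" by (simp add: add_nonneg_pos)
  hence q: "0 < q" "q * (norm n + 1) = e / 2" using assms(2) by (simp_all add: q_def field_simps)
  have r: "0 < r" "r \<le> 1" "r * (norm n + 1) \<le> e / 2"
    using q mult_right_mono[of r q "norm n + 1"] by (simp_all add: r_def)
  have "(\<Sum>\<alpha>\<in>G. cmod (coef (dilate N r n) \<alpha>)) \<le> e" if G: "finite G" "G \<subseteq> multi_indices" for G
  proof -
    have le: "cmod (coef (dilate N r n) \<alpha>) \<le> cmod (coef n \<alpha>)" for \<alpha>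
      using r by (simp add: dilate.rep_eq norm_mult norm_power mult_left_le_one_le power_le_one)
    have le_F: "cmod (coef (dilate N r n) \<alpha>) \<le> r * cmod (coef n \<alpha>)" if "\<alpha> \<in> F" for \<alpha>
    proof (cases "\<alpha> = {}")
      \<comment> \<open>The empty index gains no factor \<open>r\<close>, but its coefficient is the
        body, which vanishes.\<close>
      case True
      thus ?thesis using assms(1) by (simp add: dilate.rep_eq body_def)
    next
      case False
      have "\<alpha> \<inter> {..<N} = \<alpha>" using N that by auto
      moreover have "finite \<alpha>" using F that by (auto simp: multi_indices_def)
      ultimately have "1 \<le> card (\<alpha> \<inter> {..<N})" using False by (simp add: Suc_leI card_gt_0_iff)
      hence "r ^ card (\<alpha> \<inter> {..<N}) \<le> r ^ 1" using r by (intro power_decreasing) auto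
      thus ?thesis using r by (simp add: dilate.rep_eq norm_mult norm_power mult_right_mono)
    qed
    have norm: "(\<Sum>\<alpha>\<in>H. cmod (coef n \<alpha>)) \<le> norm n" if "finite H" "H \<subseteq> multi_indices" for H
      using that norm_supernumber_le_iff[of n "norm n"] by blast
    have "(\<Sum>\<alpha>\<in>G. cmod (coef (dilate N r n) \<alpha>)) \<le> (\<Sum>\<alpha>\<in>F \<union> (G - F). cmod (coef (dilate N r n) \<alpha>))"
      using F G by (intro sum_mono2) auto
    also have "\<dots> = (\<Sum>\<alpha>\<in>F. cmod (coef (dilate N r n) \<alpha>)) + (\<Sum>\<alpha>\<in>G - F. cmod (coef (dilate N r n) \<alpha>))"
      using F G by (intro sum.union_disjoint) auto
    also have "\<dots> \<le> (\<Sum>\<alpha>\<in>F. r * cmod (coef n \<alpha>)) + (\<Sum>\<alpha>\<in>G - F. cmod (coef n \<alpha>))"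
      by (intro add_mono sum_mono le le_F)
    also have "(\<Sum>\<alpha>\<in>F. r * cmod (coef n \<alpha>)) = r * (\<Sum>\<alpha>\<in>F. cmod (coef n \<alpha>))"
      by (simp add: sum_distrib_left)
    also have "\<dots> \<le> r * (norm n + 1)"
      using r norm[OF F(1,2)] by (intro mult_left_mono) auto
    also have "(\<Sum>\<alpha>\<in>G - F. cmod (coef n \<alpha>)) = (\<Sum>\<alpha>\<in>F \<union> (G - F). cmod (coef n \<alpha>)) - (\<Sum>\<alpha>\<in>F. cmod (coef n \<alpha>))"
      using F G by (subst sum.union_disjoint) auto
    also have "\<dots> \<le> e / 2"
      using norm[of "F \<union> (G - F)"] F G by auto
    finally show ?thesis using r by simp
  qed
  hence "norm (dilate N r n) \<le> e" by (simp add: norm_supernumber_le_iff)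
  thus ?thesis using r that[of r N] by simp
qed

section \<open>Fixed points near the unit\<close>

lemma bounded_linear_dagger: "bounded_linear dagger"
  by (rule bounded_linear_intro[where K = 1]) auto

text \<open>With the root written as \<open>1 + v\<close>, the equation becomes
  \<open>v = (n - v * v) / 2\<close>. Self-adjointness is built into the closed set \<open>S\<close>
  on which the contraction acts, so the fixed point has it.\<close>

lemma sqrt_near_one:
  fixes n :: supernumber
  assumes "n\<^sup>\<dagger> = n" "norm n \<le> 1 / 2"
  shows "\<exists>w. w\<^sup>\<dagger> = w \<and> w * w = 1 + n"
proof -
  define S where "S = {v :: supernumber. v\<^sup>\<dagger> = v \<and> norm v \<le> 1 / 2}"
  define f where "f v = (1 / 2) *\<^sub>R (n - v * v)" for v
  have "complete S"
    unfolding complete_eq_closed S_def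
    by (intro closed_Collect_conj closed_Collect_eq closed_Collect_le continuous_intros
        bounded_linear.continuous_on[OF bounded_linear_dagger])
  moreover have "0 \<in> S" by (simp add: S_def)
  moreover have "f v \<in> S" if "v \<in> S" for v
  proof -
    have "norm (v * v) \<le> norm v * norm v" by (rule norm_mult_ineq)
    also have "\<dots> \<le> 1 / 2 * (1 / 2)" using that by (intro mult_mono) (auto simp: S_def)
    finally have "norm (n - v * v) \<le> 1"
      using assms(2) norm_triangle_ineq4[of n "v * v"] by simp
    thus ?thesis using that assms(1) by (simp add: S_def f_def)
  qed
  moreover have "dist (f u) (f v) \<le> 1 / 2 * dist u v" if "u \<in> S" "v \<in> S" for u v
  proof -
    \<comment> \<open>The difference of the squares is split without commuting \<open>u\<close> and
      \<open>v\<close>. The bound 1/2 on both norms, with the factor 1/2 in \<open>f\<close>, gives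
      the contraction constant 1/2.\<close>
    have "norm (v * (v - u) + (v - u) * u) \<le> norm v * norm (v - u) + norm (v - u) * norm u"
      by (intro norm_triangle_le add_mono norm_mult_ineq)
    also have "\<dots> \<le> 1 / 2 * norm (v - u) + norm (v - u) * (1 / 2)"
      using that by (intro add_mono mult_mono) (auto simp: S_def)
    finally have "norm (v * (v - u) + (v - u) * u) \<le> norm (u - v)"
      by (simp add: norm_minus_commute)
    moreover have "f u - f v = (1 / 2) *\<^sub>R (v * (v - u) + (v - u) * u)"
      by (simp add: f_def algebra_simps flip: scaleR_diff_right)
    ultimately show ?thesis by (simp add: dist_norm)
  qed
  ultimately have "\<exists>!v\<in>S. f v = v"
    by (intro Banach_fix[where c = "1 / 2"]) auto
  then obtain v where v: "v\<^sup>\<dagger> = v" "f v = v" by (auto simp: S_def)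
  have "v + v = 2 *\<^sub>R f v" unfolding v(2) by (simp add: scaleR_2)
  hence "(1 + v) * (1 + v) = 1 + n" by (simp add: f_def algebra_simps)
  thus ?thesis using v(1) by (intro exI[of _ "1 + v"]) simp
qed

text \<open>A right inverse is a fixed point of \<open>w \<mapsto> 1 - n * w\<close>, a contraction
  with constant 1/2.\<close>

lemma right_inverse_near_one:
  fixes n :: "'a :: {banach, real_normed_algebra_1}"
  assumes "norm n \<le> 1 / 2"
  shows "\<exists>w. (1 + n) * w = 1"
proof -
  have "dist (1 - n * x) (1 - n * y) \<le> 1 / 2 * dist x y" for x y
  proof -
    have "norm (n * (y - x)) \<le> 1 / 2 * norm (y - x)"
      using norm_mult_ineq[of n "y - x"] mult_right_mono[OF assms norm_ge_zero, of "y - x"] by simp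
    thus ?thesis by (simp add: dist_norm norm_minus_commute algebra_simps)
  qed
  then obtain w where "1 - n * w = w"
    using banach_fix_type[of "1 / 2" "\<lambda>w. 1 - n * w"] by auto
  hence "(1 + n) * w = 1" by (simp add: algebra_simps)
  thus ?thesis by blast
qed

section \<open>Positive bodies and positive supernumbers\<close>

lemma positive_body_decomp:
  assumes "0 < body z"
  obtains b n where "b > 0" "z = b *\<^sub>R (1 + n)" "body n = 0" "z\<^sup>\<dagger> = z \<Longrightarrow> n\<^sup>\<dagger> = n"
proof
  \<comment> \<open>Dividing by the body, a positive real number, leaves an element of body 1.
    Self-adjointness of \<open>n\<close> is conditional because inverses are also taken of elements
    not yet known to be self-adjoint.\<close>
  define b where "b = Re (body z)"
  have b: "b > 0" "body z = of_real b"
    using assms by (auto simp: b_def less_complex_def complex_eq_iff)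
  show "b > 0" by fact
  show "z = b *\<^sub>R (1 + (inverse b *\<^sub>R z - 1))" "body (inverse b *\<^sub>R z - 1) = 0"
    "z\<^sup>\<dagger> = z \<Longrightarrow> (inverse b *\<^sub>R z - 1)\<^sup>\<dagger> = inverse b *\<^sub>R z - 1"
    using b by simp_all
qed

text \<open>Dilations respect products and conjugation, so a self-adjoint root found where the part
  of body 0 is small is carried back by the inverse dilation.\<close>

lemma positive_body_sqrt:
  assumes "z\<^sup>\<dagger> = z" "0 < body z"
  shows "\<exists>w. w\<^sup>\<dagger> = w \<and> w * w = z"
proof -
  obtain b n where bn: "b > 0" "z = b *\<^sub>R (1 + n)" "body n = 0" "n\<^sup>\<dagger> = n"
    using positive_body_decomp[OF assms(2)] assms(1) by metis
  obtain N r where r: "r \<noteq> 0" "norm (dilate N r n) \<le> 1 / 2"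
    by (rule dilate_small[OF bn(3), of "1 / 2"]) simp
  obtain w where w: "w\<^sup>\<dagger> = w" "w * w = 1 + dilate N r n"
    using sqrt_near_one[of "dilate N r n"] r bn(4) dilate_simps(4)[of N r n] by auto
  define u where "u = dilate N (inverse r) w"
  have "u\<^sup>\<dagger> = u" using w(1) dilate_simps(4)[of N "inverse r" w] by (simp add: u_def)
  moreover have "u * u = 1 + n"
    using r by (simp add: u_def w(2) flip: dilate_mult)
  ultimately show ?thesis
    using bn by (intro exI[of _ "sqrt b *\<^sub>R u"]) simp
qed

lemma positive_body_right_inverse:
  assumes "0 < body z"
  shows "\<exists>w. z * w = 1"
proof -
  obtain b n where bn: "b > 0" "z = b *\<^sub>R (1 + n)" "body n = 0"
    using positive_body_decomp[OF assms] by metis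
  obtain N r where r: "r \<noteq> 0" "norm (dilate N r n) \<le> 1 / 2"
    by (rule dilate_small[OF bn(3), of "1 / 2"]) simp
  obtain w where w: "(1 + dilate N r n) * w = 1"
    using right_inverse_near_one r by blast
  have "(1 + n) * dilate N (inverse r) w = dilate N (inverse r) ((1 + dilate N r n) * w)"
    using r by simp
  hence "(1 + n) * dilate N (inverse r) w = 1" by (simp only: w dilate_simps)
  thus ?thesis using bn by (intro exI[of _ "inverse b *\<^sub>R dilate N (inverse r) w"]) simp
qed

text \<open>The contraction yields right inverses only. The right inverse \<open>w\<close> of
  \<open>z\<close> has the reciprocal body, again positive, hence a right inverse \<open>u\<close>
  of its own, and \<open>z = z * (w * u) = u\<close> makes \<open>w\<close> two-sided.\<close>

lemma positive_body_invertible: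
  assumes "0 < body z"
  shows "super_invertible z"
proof -
  obtain w where w: "z * w = 1" using positive_body_right_inverse[OF assms] by blast
  have "body z * body w = 1" using arg_cong[OF w, of body] by simp
  hence "Re (body z) * Re (body w) = 1" "Im (body w) = 0" "Re (body z) > 0"
    using assms by (auto simp: less_complex_def complex_eq_iff)
  hence "0 < body w"
    using zero_less_mult_pos[of "Re (body z)" "Re (body w)"] by (simp add: less_complex_def)
  then obtain u where u: "w * u = 1" using positive_body_right_inverse by blast
  have "z = z * (w * u)" by (simp add: u)
  also have "\<dots> = u" by (simp add: w flip: mult.assoc)
  finally show ?thesis using w u unfolding super_invertible_def by blast
qed

text \<open>The body of \<open>w * w\<^sup>\<dagger>\<close> is a squared modulus, nonzero when the
  element is invertible. Conversely, a self-adjoint root satisfies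
  \<open>w * w\<^sup>\<dagger> = w * w\<close>.\<close>

lemma superpos_iff: "superpos z \<longleftrightarrow> z\<^sup>\<dagger> = z \<and> 0 < body z"
proof
  assume "superpos z"
  then obtain w v where w: "z = w * w\<^sup>\<dagger>" and "z * v = 1"
    unfolding superpos_def super_invertible_def by blast
  hence "body z * body v = 1" using body_simps(6)[of z v] by simp
  hence "body z \<noteq> 0" by auto
  thus "z\<^sup>\<dagger> = z \<and> 0 < body z"
    by (auto simp: w less_complex_def simp flip: complex_norm_square)
next
  assume "z\<^sup>\<dagger> = z \<and> 0 < body z"
  thus "superpos z"
    unfolding superpos_def using positive_body_invertible positive_body_sqrt by metis
qed

text \<open>The body of a self-adjoint root is real and nonzero, so the root or its negative is
  positive. The positive one will stand on the diagonal of a Cholesky factor.\<close>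

lemma superpos_sqrt:
  assumes "superpos z"
  obtains w where "superpos w" "w * w = z"
proof -
  obtain w where w: "w\<^sup>\<dagger> = w" "w * w = z"
    using assms positive_body_sqrt by (auto simp: superpos_iff)
  have real: "Im (body w) = 0"
    using arg_cong[OF w(1), of body] by (simp add: complex_eq_iff)
  have "0 < body w * body w" using assms arg_cong[OF w(2), of body] by (simp add: superpos_iff)
  hence "Re (body w) \<noteq> 0" using real by (auto simp: less_complex_def)
  hence "superpos w \<or> superpos (- w)"
    using w(1) real by (auto simp: superpos_iff less_complex_def)
  thus ?thesis using w(2) that[of w] that[of "- w"] by auto
qed

text \<open>Conjugating \<open>z * w = 1\<close> shows that \<open>w\<^sup>\<dagger>\<close> is a
  left inverse, hence equal to \<open>w\<close>.\<close>

lemma superpos_inverse: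
  assumes "superpos z"
  obtains w where "z * w = 1" "w * z = 1" "w\<^sup>\<dagger> = w"
proof -
  obtain w where w: "z * w = 1" "w * z = 1"
    using assms unfolding superpos_def super_invertible_def by blast
  have "w\<^sup>\<dagger> * z = (z * w)\<^sup>\<dagger>" using assms by (simp add: superpos_iff)
  hence "w\<^sup>\<dagger> * z * w = w" by (simp add: w)
  hence "w\<^sup>\<dagger> = w" by (simp add: mult.assoc w)
  thus ?thesis using w that by blast
qed

section \<open>Hermitian forms\<close>

text \<open>The type carries real scalar multiplication only. Complex scalars, needed for test
  vectors and for polarization, enter as multiples of the unit.\<close>

lift_definition super_of_complex :: "complex \<Rightarrow> supernumber"
  is "\<lambda>c \<alpha>. if \<alpha> = {} then c else 0"
proof -
  fix c :: complex
  have "(\<lambda>\<alpha>. cmod (if \<alpha> = {} then c else 0)) summable_on multi_indices \<longleftrightarrow>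
        (\<lambda>\<alpha>. cmod (if \<alpha> = {} then c else 0)) summable_on {{} :: nat set}"
    by (rule summable_on_cong_neutral) (auto simp: multi_indices_def)
  thus "?thesis c" by (simp add: multi_indices_def)
qed

lemma body_of_complex [simp]: "body (super_of_complex c) = c"
  by (simp add: body_def super_of_complex.rep_eq)

lemma dagger_of_complex [simp]: "(super_of_complex c)\<^sup>\<dagger> = super_of_complex (cnj c)"
  by (rule supernumber_eqI) (simp add: dagger.rep_eq super_of_complex.rep_eq)

text \<open>Both orders give the same coefficients, so complex scalars are central; polarization
  with \<open>\<i>\<close> relies on this.\<close>

lemma coef_mult_of_complex:
  "coef (super_of_complex c * z) \<gamma> = c * coef z \<gamma>" "coef (z * super_of_complex c) \<gamma> = c * coef z \<gamma>"
proof -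
  consider "finite \<gamma>" | "infinite \<gamma>" "coef z \<gamma> = 0"
    by (auto simp: coef_outside multi_indices_def)
  thus "coef (super_of_complex c * z) \<gamma> = c * coef z \<gamma>"
  proof cases
    case 1
    have "coef (super_of_complex c * z) \<gamma> = (\<Sum>\<alpha>\<in>Pow \<gamma>. if \<alpha> = {} then c * coef z \<gamma> else 0)"
      unfolding times_supernumber.rep_eq super_of_complex.rep_eq super_conv_def
      by (rule sum.cong) auto
    thus ?thesis using 1 by simp
  qed (simp add: times_supernumber.rep_eq super_conv_infinite)
  consider "finite \<gamma>" | "infinite \<gamma>" "coef z \<gamma> = 0"
    by (auto simp: coef_outside multi_indices_def)
  thus "coef (z * super_of_complex c) \<gamma> = c * coef z \<gamma>"
  proof cases
    case 1
    have "coef (z * super_of_complex c) \<gamma> = (\<Sum>\<alpha>\<in>Pow \<gamma>. if \<alpha> = \<gamma> then c * coef z \<gamma> else 0)"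
      unfolding times_supernumber.rep_eq super_of_complex.rep_eq super_conv_def
      by (rule sum.cong) auto
    thus ?thesis using 1 by simp
  qed (simp add: times_supernumber.rep_eq super_conv_infinite)
qed

text \<open>The entry of \<open>c\<^sup>\<star> M c\<close>, for matrices and vectors given as total
  functions that are read only below \<open>p\<close>; shifting and reversing indices then needs no
  block matrices.\<close>

definition super_form :: "nat \<Rightarrow> (nat \<Rightarrow> nat \<Rightarrow> supernumber) \<Rightarrow> (nat \<Rightarrow> supernumber) \<Rightarrow> supernumber"
  where "super_form p f c = (\<Sum>i<p. \<Sum>j<p. (c i)\<^sup>\<dagger> * f i j * c j)"

definition form_superpos :: "nat \<Rightarrow> (nat \<Rightarrow> nat \<Rightarrow> supernumber) \<Rightarrow> bool" where
  "form_superpos p f \<longleftrightarrow> (\<forall>c. (\<exists>i<p. body (c i) \<noteq> 0) \<longrightarrow> superpos (super_form p f c))"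

lemma form_superposD:
  "form_superpos p f \<Longrightarrow> i < p \<Longrightarrow> body (c i) \<noteq> 0 \<Longrightarrow> superpos (super_form p f c)"
  unfolding form_superpos_def by blast

lemma super_form_support:
  assumes "S \<subseteq> {..<p}" "\<And>i. i \<notin> S \<Longrightarrow> c i = 0"
  shows "super_form p f c = (\<Sum>i\<in>S. \<Sum>j\<in>S. (c i)\<^sup>\<dagger> * f i j * c j)"
proof -
  have "super_form p f c = (\<Sum>i\<in>S. \<Sum>j<p. (c i)\<^sup>\<dagger> * f i j * c j)"
    unfolding super_form_def by (rule sum.mono_neutral_right) (use assms in auto)
  also have "\<dots> = (\<Sum>i\<in>S. \<Sum>j\<in>S. (c i)\<^sup>\<dagger> * f i j * c j)"
    by (intro sum.cong refl sum.mono_neutral_right) (use assms in auto)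
  finally show ?thesis .
qed

lemma dagger_super_form: "(super_form p f c)\<^sup>\<dagger> = super_form p (\<lambda>i j. (f j i)\<^sup>\<dagger>) c"
  unfolding super_form_def dagger_sum by (subst sum.swap) (simp add: mult.assoc)

lemma body_super_form:
  "body (super_form p f c) = (\<Sum>i<p. \<Sum>j<p. cnj (body (c i)) * body (f i j) * body (c j))"
  by (simp add: super_form_def body_sum)

lemma form_superpos_diagonal_entry:
  assumes "form_superpos p f" "i < p"
  shows "superpos (f i i)"
proof -
  have "superpos (super_form p f (\<lambda>j. if j = i then 1 else 0))"
    using assms by (rule form_superposD) simp
  also have "super_form p f (\<lambda>j. if j = i then 1 else 0) = f i i"
    by (subst super_form_support[of "{i}"]) (use assms in auto)
  finally show ?thesis .
qed

text \<open>Polarization with the vectors \<open>e\<^sub>j + a e\<^sub>k\<close>, \<open>a \<in> {1, i}\<close>, gives self-adjointness.\<close>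

lemma form_superpos_hermitian:
  assumes "form_superpos p f" "j < p" "k < p"
  shows "(f k j)\<^sup>\<dagger> = f j k"
proof (cases "j = k")
  case True
  thus ?thesis using form_superpos_diagonal_entry[OF assms(1)] assms by (simp add: superpos_iff)
next
  case False
  \<comment> \<open>\<open>N\<close> measures the failure of self-adjointness; its form vanishes
    wherever the form of \<open>f\<close> takes a self-adjoint value.\<close>
  define N where "N i l = f i l - (f l i)\<^sup>\<dagger>" for i l
  have diag: "N i i = 0" if "i < p" for i
    using form_superpos_diagonal_entry[OF assms(1) that] by (simp add: N_def superpos_iff)
  have pair: "N j k * a + a\<^sup>\<dagger> * N k j = 0" for a
  proof -
    \<comment> \<open>The entry 1 at \<open>j\<close> keeps the body of the test vector nonzero
      whatever \<open>a\<close> is.\<close>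
    define c where "c i = (if i = j then 1 else if i = k then a else 0)" for i
    have "superpos (super_form p f c)"
      using assms(1,2) by (rule form_superposD) (simp add: c_def)
    hence "super_form p f c = super_form p (\<lambda>i j. (f j i)\<^sup>\<dagger>) c"
      by (simp add: superpos_iff dagger_super_form)
    hence "0 = super_form p N c"
      by (simp add: super_form_def N_def algebra_simps sum_subtractf)
    also have "\<dots> = N j k * a + a\<^sup>\<dagger> * N k j"
      using False assms by (subst super_form_support[of "{j, k}"]) (auto simp: c_def diag)
    finally show ?thesis by simp
  qed
  \<comment> \<open>\<open>a = 1\<close> makes \<open>N\<close> antisymmetric at this pair;
    \<open>a = \<i>\<close> then leaves \<open>2 \<i> N j k = 0\<close>.\<close>
  have "N k j = - N j k" using pair[of 1] by (simp add: eq_neg_iff_add_eq_0 add.commute)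
  hence *: "N j k * super_of_complex \<i> - super_of_complex (- \<i>) * N j k = 0"
    using pair[of "super_of_complex \<i>"] by simp
  have "N j k = 0"
  proof (rule supernumber_eqI)
    fix \<gamma>
    show "coef (N j k) \<gamma> = coef 0 \<gamma>"
      using arg_cong[OF *, of "\<lambda>z. coef z \<gamma>"]
      by (simp add: minus_supernumber.rep_eq zero_supernumber.rep_eq coef_mult_of_complex)
  qed
  thus ?thesis by (simp add: N_def)
qed

text \<open>The body is multiplicative, so the body of the form at \<open>c\<close> is the form of
  the bodies at the body of \<open>c\<close>. Every complex vector arises as such a body, through
  \<open>super_of_complex\<close>.\<close>

lemma form_superpos_iff:
  "form_superpos p f \<longleftrightarrow> (\<forall>i<p. \<forall>j<p. (f j i)\<^sup>\<dagger> = f i j) \<and>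
    (\<forall>v :: nat \<Rightarrow> complex. (\<exists>i<p. v i \<noteq> 0) \<longrightarrow> 0 < (\<Sum>i<p. \<Sum>j<p. cnj (v i) * body (f i j) * v j))"
    (is "_ \<longleftrightarrow> ?herm \<and> ?pos")
proof (intro iffI conjI)
  assume f: "form_superpos p f"
  thus ?herm using form_superpos_hermitian by blast
  show ?pos
  proof (intro allI impI)
    fix v :: "nat \<Rightarrow> complex" assume "\<exists>i<p. v i \<noteq> 0"
    hence "superpos (super_form p f (\<lambda>i. super_of_complex (v i)))"
      using f by (simp add: form_superpos_def)
    thus "0 < (\<Sum>i<p. \<Sum>j<p. cnj (v i) * body (f i j) * v j)"
      by (simp add: superpos_iff body_super_form)
  qed
next
  assume "?herm \<and> ?pos"
  hence herm: ?herm and pos: ?pos by blast+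
  show "form_superpos p f"
    unfolding form_superpos_def superpos_iff
  proof (intro allI impI conjI)
    fix c assume c: "\<exists>i<p. body (c i) \<noteq> 0"
    show "(super_form p f c)\<^sup>\<dagger> = super_form p f c"
      using herm unfolding dagger_super_form by (simp add: super_form_def)
    show "0 < body (super_form p f c)"
      using pos c by (simp add: body_super_form)
  qed
qed

lemma form_superpos_diagonal:
  assumes "\<And>i. i < p \<Longrightarrow> superpos (d i)"
  shows "form_superpos p (\<lambda>i j. if i = j then d i else 0)"
  unfolding form_superpos_iff
proof (intro conjI allI impI)
  fix v :: "nat \<Rightarrow> complex" assume "\<exists>i<p. v i \<noteq> 0"
  then obtain k where k: "k < p" "v k \<noteq> 0" by blast
  have d: "body (d i) = of_real (Re (body (d i)))" "Re (body (d i)) > 0" if "i < p" for i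
    using assms[OF that] by (auto simp: superpos_iff less_complex_def complex_eq_iff)
  have "(\<Sum>i<p. \<Sum>j<p. cnj (v i) * body (if i = j then d i else 0) * v j) =
      (\<Sum>i<p. \<Sum>j<p. if j = i then cnj (v i) * body (d i) * v i else 0)"
    by (intro sum.cong refl) auto
  also have "\<dots> = (\<Sum>i<p. cnj (v i) * body (d i) * v i)" by simp
  also have "\<dots> = (\<Sum>i<p. of_real (Re (body (d i)) * (cmod (v i))\<^sup>2))"
  proof (rule sum.cong)
    fix i assume "i \<in> {..<p}"
    hence "cnj (v i) * body (d i) * v i = of_real (Re (body (d i))) * (v i * cnj (v i))"
      using d(1)[of i] by (simp add: mult_ac)
    thus "cnj (v i) * body (d i) * v i = of_real (Re (body (d i)) * (cmod (v i))\<^sup>2)"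
      by (simp flip: complex_norm_square)
  qed simp
  also have "\<dots> = of_real (\<Sum>i<p. Re (body (d i)) * (cmod (v i))\<^sup>2)" by simp
  finally have eq: "(\<Sum>i<p. \<Sum>j<p. cnj (v i) * body (if i = j then d i else 0) * v j) = \<dots>" .
  have "0 < (\<Sum>i<p. Re (body (d i)) * (cmod (v i))\<^sup>2)"
    by (rule sum_pos2[of _ k]) (use k d(2) in \<open>auto intro!: mult_nonneg_nonneg intro: less_imp_le\<close>)
  thus "0 < (\<Sum>i<p. \<Sum>j<p. cnj (v i) * body (if i = j then d i else 0) * v j)"
    unfolding eq by (simp add: less_complex_def)
qed (use assms in \<open>auto simp: superpos_iff\<close>)

section \<open>Triangular factorisations\<close>

text \<open>Eliminating the first variable \<open>c\<^sub>0 = - d\<^sup>-\<^sup>1 (\<Sum>\<^sub>j f\<^sub>0\<^sub>j c\<^sub>j)\<close> turns the form of \<open>f\<close> into that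
  of its Schur complement.\<close>

lemma form_superpos_Schur:
  assumes f: "form_superpos (Suc p) f" and e: "f 0 0 * e = 1"
  shows "form_superpos p (\<lambda>i j. f (Suc i) (Suc j) - f (Suc i) 0 * e * f 0 (Suc j))"
  unfolding form_superpos_def
proof (intro allI impI)
  fix c assume "\<exists>i<p. body (c i) \<noteq> 0"
  define b where "b = (\<Sum>j<p. f 0 (Suc j) * c j)"
  define b' where "b' = (\<Sum>i<p. (c i)\<^sup>\<dagger> * f (Suc i) 0)"
  define a where "a = - (e * b)"
  define c' where "c' = case_nat a c"
  obtain i where "i < p" "body (c i) \<noteq> 0" using \<open>\<exists>i<p. body (c i) \<noteq> 0\<close> by blast
  \<comment> \<open>The nonzero body at \<open>i\<close> moves to \<open>Suc i\<close>, so the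
    prepended entry \<open>a\<close> can be chosen freely.\<close>
  hence pos: "superpos (super_form (Suc p) f c')"
    by (intro form_superposD[OF f, of "Suc i"]) (auto simp: c'_def)
  have "super_form (Suc p) f c' = (a\<^sup>\<dagger> * f 0 0 * a + a\<^sup>\<dagger> * b) + b' * a +
      (\<Sum>i<p. \<Sum>j<p. (c i)\<^sup>\<dagger> * f (Suc i) (Suc j) * c j)"
    unfolding super_form_def sum.lessThan_Suc_shift
    by (simp add: c'_def b_def b'_def sum.distrib sum_distrib_left sum_distrib_right mult.assoc add_ac)
  \<comment> \<open>By its choice \<open>a\<close> solves \<open>f 0 0 * a + b = 0\<close>, which
    removes all terms with the conjugate of \<open>a\<close> on the left.\<close>
  also have "a\<^sup>\<dagger> * f 0 0 * a + a\<^sup>\<dagger> * b = a\<^sup>\<dagger> * (b - f 0 0 * e * b)"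
    by (simp add: a_def algebra_simps)
  also have "\<dots> = 0" by (simp add: e(1))
  also have "b' * a = - (\<Sum>i<p. \<Sum>j<p. (c i)\<^sup>\<dagger> * (f (Suc i) 0 * e * f 0 (Suc j)) * c j)"
    by (simp add: a_def b'_def b_def sum_distrib_left[of e] sum_product mult.assoc)
  also have "0 + - (\<Sum>i<p. \<Sum>j<p. (c i)\<^sup>\<dagger> * (f (Suc i) 0 * e * f 0 (Suc j)) * c j) +
      (\<Sum>i<p. \<Sum>j<p. (c i)\<^sup>\<dagger> * f (Suc i) (Suc j) * c j) =
      super_form p (\<lambda>i j. f (Suc i) (Suc j) - f (Suc i) 0 * e * f 0 (Suc j)) c"
    by (simp add: super_form_def right_diff_distrib left_diff_distrib sum_subtractf)
  finally show "superpos (super_form p (\<lambda>i j. f (Suc i) (Suc j) - f (Suc i) 0 * e * f 0 (Suc j)) c)"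
    using pos by simp
qed

text \<open>Induction on \<open>p\<close> for all \<open>f\<close>, since the hypothesis is applied
  to the Schur complement. Ones and zeros of \<open>l\<close> are claimed at all indices, not only
  below \<open>p\<close>, so that the index shift carries no side conditions.\<close>

lemma form_superpos_LDL:
  assumes "form_superpos p f"
  shows "\<exists>l d. (\<forall>i. l i i = 1) \<and> (\<forall>j. \<forall>i<j. l i j = 0) \<and> (\<forall>k<p. superpos (d k)) \<and>
    (\<forall>i<p. \<forall>j<p. f i j = (\<Sum>k<p. l i k * d k * (l j k)\<^sup>\<dagger>))"
  using assms
proof (induction p arbitrary: f)
  case 0
  show ?case by (rule exI[of _ "\<lambda>i j. if i = j then 1 else 0"]) auto
next
  case (Suc p)
  have f00: "superpos (f 0 0)" using form_superpos_diagonal_entry[OF Suc.prems] by simp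
  obtain e where e: "f 0 0 * e = 1" "e * f 0 0 = 1" "e\<^sup>\<dagger> = e"
    using superpos_inverse[OF f00] by blast
  obtain l d where ld: "\<And>i. l i i = 1" "\<And>i j. i < j \<Longrightarrow> l i j = 0" "\<And>k. k < p \<Longrightarrow> superpos (d k)"
    "\<And>i j. i < p \<Longrightarrow> j < p \<Longrightarrow> f (Suc i) (Suc j) - f (Suc i) 0 * e * f 0 (Suc j) =
      (\<Sum>k<p. l i k * d k * (l j k)\<^sup>\<dagger>)"
    using Suc.IH[OF form_superpos_Schur[OF Suc.prems e(1)]] by blast
  define d' where "d' = case_nat (f 0 0) d"
  \<comment> \<open>The first column is that of \<open>f\<close> times the inverse pivot; the factor
    of the Schur complement moves one step down and to the right.\<close>
  define l' where "l' i k = (case k of 0 \<Rightarrow> (case i of 0 \<Rightarrow> 1 | Suc _ \<Rightarrow> f i 0 * e)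
    | Suc k' \<Rightarrow> (case i of 0 \<Rightarrow> 0 | Suc i' \<Rightarrow> l i' k'))" for i k
  have f: "f i j = (\<Sum>k<Suc p. l' i k * d' k * (l' j k)\<^sup>\<dagger>)" if ij: "i < Suc p" "j < Suc p" for i j
  proof -
    have herm: "(f j 0)\<^sup>\<dagger> = f 0 j" using form_superpos_hermitian[OF Suc.prems _ ij(2), of 0] by simp
    have cancel: "f 0 0 * (e * z) = z" "e * (f 0 0 * z) = z" for z
      by (simp_all add: e flip: mult.assoc)
    show ?thesis
    proof (cases i; cases j)
      fix i' j' assume [simp]: "i = Suc i'" "j = Suc j'"
      \<comment> \<open>The first term is what the Schur complement subtracts. It is the summand
        \<open>k = 0\<close>, because \<open>e * f 0 0 * e = e\<close> and both \<open>e\<close> and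
        the family \<open>f\<close> are self-adjoint.\<close>
      have "f i j = f i 0 * e * f 0 j + (\<Sum>k<p. l i' k * d k * (l j' k)\<^sup>\<dagger>)"
        using ij by (simp flip: ld(4))
      thus ?thesis
        using herm by (simp add: sum.lessThan_Suc_shift l'_def d'_def e(3) mult.assoc cancel del: sum.lessThan_Suc)
    qed (use herm in \<open>auto simp: sum.lessThan_Suc_shift l'_def d'_def e mult.assoc cancel
        simp del: sum.lessThan_Suc\<close>)
  qed
  have "\<forall>i. l' i i = 1" "\<forall>j. \<forall>i<j. l' i j = 0" "\<forall>k<Suc p. superpos (d' k)"
    using ld f00 by (auto simp: l'_def d'_def split: nat.split)
  thus ?case using f by blast
qed

text \<open>Each pivot is \<open>w k * w k\<close> with \<open>w k\<close> self-adjoint, and one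
  half goes to each side. Since \<open>l\<close> has ones on its diagonal, the new diagonal entries
  are the positive roots \<open>w k\<close>.\<close>

lemma form_superpos_Cholesky:
  assumes "form_superpos p f"
  shows "\<exists>l. (\<forall>i<p. superpos (l i i)) \<and> (\<forall>j<p. \<forall>i<j. l i j = 0) \<and>
    (\<forall>i<p. \<forall>j<p. f i j = (\<Sum>k<p. l i k * (l j k)\<^sup>\<dagger>))"
proof -
  obtain l d where ld: "\<And>i. l i i = 1" "\<And>i j. i < j \<Longrightarrow> l i j = 0" "\<And>k. k < p \<Longrightarrow> superpos (d k)"
    "\<And>i j. i < p \<Longrightarrow> j < p \<Longrightarrow> f i j = (\<Sum>k<p. l i k * d k * (l j k)\<^sup>\<dagger>)"
    using form_superpos_LDL[OF assms] by blast
  have "\<exists>w. superpos w \<and> w * w = d k" if "k < p" for k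
    using superpos_sqrt[OF ld(3)[OF that]] by blast
  then obtain w where w: "\<And>k. k < p \<Longrightarrow> superpos (w k)" "\<And>k. k < p \<Longrightarrow> w k * w k = d k"
    by metis
  have "f i j = (\<Sum>k<p. l i k * w k * (l j k * w k)\<^sup>\<dagger>)" if "i < p" "j < p" for i j
  proof -
    have "l i k * d k * (l j k)\<^sup>\<dagger> = l i k * w k * (l j k * w k)\<^sup>\<dagger>" if "k < p" for k
      using w(1)[OF that] w(2)[OF that, symmetric] by (simp add: superpos_iff mult.assoc)
    thus ?thesis using ld(4)[OF that] by simp
  qed
  thus ?thesis using ld w by (intro exI[of _ "\<lambda>i k. l i k * w k"]) auto
qed

text \<open>The reversed form at \<open>c\<close> is the form of \<open>f\<close> at the reversed
  vector, whose body is nonzero together with that of \<open>c\<close>.\<close>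

lemma form_superpos_reverse:
  assumes "form_superpos p f"
  shows "form_superpos p (\<lambda>i j. f (p - Suc i) (p - Suc j))"
  unfolding form_superpos_def
proof (intro allI impI)
  fix c assume "\<exists>i<p. body (c i) \<noteq> 0"
  then obtain i where i: "i < p" "body (c i) \<noteq> 0" by blast
  have "superpos (super_form p f (\<lambda>i. c (p - Suc i)))"
    by (rule form_superposD[OF assms, of "p - Suc i"]) (use i in \<open>simp_all add: Suc_diff_Suc\<close>)
  also have "super_form p f (\<lambda>i. c (p - Suc i)) =
      (\<Sum>i<p. \<Sum>j<p. (c i)\<^sup>\<dagger> * f (p - Suc i) (p - Suc j) * c j)"
    unfolding super_form_def
    by (subst (1 2) sum.nat_diff_reindex[symmetric]) (simp add: Suc_diff_Suc)
  finally show "superpos (super_form p (\<lambda>i j. f (p - Suc i) (p - Suc j)) c)"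
    by (simp add: super_form_def)
qed

section \<open>Superpositive matrices\<close>

lemma super_adjoint_carrier [simp]: "A \<in> carrier_mat m n \<Longrightarrow> A\<^sup>\<star> \<in> carrier_mat n m"
  by (simp add: super_adjoint_def)

lemma super_adjoint_adjoint [simp]: "(A\<^sup>\<star>)\<^sup>\<star> = A"
  by (rule eq_matI) (auto simp: super_adjoint_def)

lemma index_super_adjoint [simp]:
  "A \<in> carrier_mat m n \<Longrightarrow> i < n \<Longrightarrow> j < m \<Longrightarrow> A\<^sup>\<star> $$ (i, j) = (A $$ (j, i))\<^sup>\<dagger>"
  by (simp add: super_adjoint_def)

lemma index_mult_mat_sum:
  assumes "A \<in> carrier_mat m n" "B \<in> carrier_mat n q" "i < m" "j < q"
  shows "(A * B) $$ (i, j) = (\<Sum>k<n. A $$ (i, k) * B $$ (k, j))"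
  using assms by (simp add: scalar_prod_def atLeast0LessThan)

lemma eq_mult_super_adjointI:
  assumes "M \<in> carrier_mat p p" "A \<in> carrier_mat p p" "B \<in> carrier_mat p p"
    and "\<And>i j. i < p \<Longrightarrow> j < p \<Longrightarrow> M $$ (i, j) = (\<Sum>k<p. A $$ (i, k) * (B $$ (j, k))\<^sup>\<dagger>)"
  shows "M = A * B\<^sup>\<star>"
proof (rule eq_matI)
  have B: "B\<^sup>\<star> \<in> carrier_mat p p" using assms(3) by simp
  thus "dim_row M = dim_row (A * B\<^sup>\<star>)" "dim_col M = dim_col (A * B\<^sup>\<star>)"
    using assms(1,2) by (metis carrier_matD(1) index_mult_mat(2), metis carrier_matD(2) index_mult_mat(3))
  fix i j assume "i < dim_row (A * B\<^sup>\<star>)" "j < dim_col (A * B\<^sup>\<star>)"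
  hence ij: "i < p" "j < p" using assms(2) B by auto
  show "M $$ (i, j) = (A * B\<^sup>\<star>) $$ (i, j)"
    unfolding index_mult_mat_sum[OF assms(2) B ij] assms(4)[OF ij]
    by (rule sum.cong) (use ij assms(3) in auto)
qed

lemma super_adjoint_mult:
  assumes "A \<in> carrier_mat m n" "B \<in> carrier_mat n q"
  shows "(A * B)\<^sup>\<star> = B\<^sup>\<star> * A\<^sup>\<star>"
proof (rule eq_matI)
  fix i j assume "i < dim_row (B\<^sup>\<star> * A\<^sup>\<star>)" "j < dim_col (B\<^sup>\<star> * A\<^sup>\<star>)"
  hence ij: "i < q" "j < m" using assms by (auto simp: super_adjoint_def)
  show "(A * B)\<^sup>\<star> $$ (i, j) = (B\<^sup>\<star> * A\<^sup>\<star>) $$ (i, j)"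
    using assms ij index_super_adjoint[OF mult_carrier_mat[OF assms] ij]
    by (simp add: index_mult_mat_sum[of _ m n _ q] index_mult_mat_sum[of _ q n _ m] dagger_sum del: index_mult_mat)
qed (use assms in \<open>auto simp: super_adjoint_def\<close>)

section \<open>Matrix conditions as conditions on forms\<close>

lemma index_quadratic_form:
  assumes "M \<in> carrier_mat p p" "c \<in> carrier_mat p 1"
  shows "(c\<^sup>\<star> * M * c) $$ (0, 0) = super_form p (\<lambda>i j. M $$ (i, j)) (\<lambda>i. c $$ (i, 0))"
proof -
  have "(c\<^sup>\<star> * M * c) $$ (0, 0) = (\<Sum>j<p. (\<Sum>i<p. (c $$ (i, 0))\<^sup>\<dagger> * M $$ (i, j)) * c $$ (j, 0))"
    using assms by (simp add: index_mult_mat_sum[of _ "Suc 0" p _ "Suc 0"]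
        index_mult_mat_sum[of _ "Suc 0" p _ p] mult_carrier_mat[of _ "Suc 0" p _ p] del: index_mult_mat)
  also have "\<dots> = (\<Sum>j<p. \<Sum>i<p. (c $$ (i, 0))\<^sup>\<dagger> * M $$ (i, j) * c $$ (j, 0))"
    by (simp add: sum_distrib_right)
  also have "\<dots> = super_form p (\<lambda>i j. M $$ (i, j)) (\<lambda>i. c $$ (i, 0))"
    unfolding super_form_def by (rule sum.swap)
  finally show ?thesis .
qed

lemma body_mat_column_eq_0_iff:
  assumes "c \<in> carrier_mat p 1"
  shows "body_mat c = 0\<^sub>m p 1 \<longleftrightarrow> (\<forall>i<p. body (c $$ (i, 0)) = 0)"
  using assms by (auto simp: mat_eq_iff)

lemma superpositive_iff_form:
  assumes "M \<in> carrier_mat p p"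
  shows "superpositive M \<longleftrightarrow> form_superpos p (\<lambda>i j. M $$ (i, j))"
proof
  assume M: "superpositive M"
  show "form_superpos p (\<lambda>i j. M $$ (i, j))"
    unfolding form_superpos_def
  proof (intro allI impI)
    fix c assume c: "\<exists>i<p. body (c i) \<noteq> 0"
    define C where "C = mat p 1 (\<lambda>(i, _). c i)"
    have C: "C \<in> carrier_mat p 1" "\<And>i. i < p \<Longrightarrow> C $$ (i, 0) = c i" by (auto simp: C_def)
    have "body_mat C \<noteq> 0\<^sub>m p 1" using c C(2) unfolding body_mat_column_eq_0_iff[OF C(1)] by auto
    hence "superpos ((C\<^sup>\<star> * M * C) $$ (0, 0))"
      using M C(1) assms by (simp add: superpositive_def del: index_mult_mat)
    also have "(C\<^sup>\<star> * M * C) $$ (0, 0) = super_form p (\<lambda>i j. M $$ (i, j)) c"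
      unfolding index_quadratic_form[OF assms C(1)] by (simp add: super_form_def C(2))
    finally show "superpos (super_form p (\<lambda>i j. M $$ (i, j)) c)" .
  qed
next
  assume form: "form_superpos p (\<lambda>i j. M $$ (i, j))"
  show "superpositive M"
    unfolding superpositive_def
  proof (intro conjI ballI impI)
    fix c assume "c \<in> carrier_mat (dim_row M) 1" "body_mat c \<noteq> 0\<^sub>m (dim_row M) 1"
    hence c: "c \<in> carrier_mat p 1" "body_mat c \<noteq> 0\<^sub>m p 1" using assms by auto
    obtain i where "i < p" "body (c $$ (i, 0)) \<noteq> 0"
      using c(2) unfolding body_mat_column_eq_0_iff[OF c(1)] by blast
    thus "superpos ((c\<^sup>\<star> * M * c) $$ (0, 0))"
      unfolding index_quadratic_form[OF assms c(1)] by (rule form_superposD[OF form])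
  qed (use assms in simp)
qed

lemma quadratic_form_sum:
  fixes v :: "complex Matrix.vec"
  assumes "A \<in> carrier_mat p p" "v \<in> carrier_vec p"
  shows "(A *\<^sub>v v) \<bullet>c v = (\<Sum>i<p. \<Sum>j<p. cnj (v $ i) * A $$ (i, j) * v $ j)"
proof -
  have "(A *\<^sub>v v) \<bullet>c v = (\<Sum>i<p. (\<Sum>j<p. A $$ (i, j) * v $ j) * cnj (v $ i))"
    using assms by (simp add: scalar_prod_def atLeast0LessThan)
  thus ?thesis by (simp add: sum_distrib_left sum_distrib_right mult_ac)
qed

lemma positive_definite_iff:
  assumes "A \<in> carrier_mat p p"
  shows "positive_definite A \<longleftrightarrow>
    (\<forall>v. (\<exists>i<p. v i \<noteq> 0) \<longrightarrow> 0 < (\<Sum>i<p. \<Sum>j<p. cnj (v i) * A $$ (i, j) * v j))"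
proof
  assume A: "positive_definite A"
  show "\<forall>v. (\<exists>i<p. v i \<noteq> 0) \<longrightarrow> 0 < (\<Sum>i<p. \<Sum>j<p. cnj (v i) * A $$ (i, j) * v j)"
  proof (intro allI impI)
    fix v :: "nat \<Rightarrow> complex" assume "\<exists>i<p. v i \<noteq> 0"
    hence "Matrix.vec p v \<noteq> 0\<^sub>v p" by (auto simp: Matrix.vec_eq_iff)
    hence "0 < (A *\<^sub>v Matrix.vec p v) \<bullet>c Matrix.vec p v"
      using A assms by (simp add: positive_definite_def)
    thus "0 < (\<Sum>i<p. \<Sum>j<p. cnj (v i) * A $$ (i, j) * v j)"
      by (simp add: quadratic_form_sum[OF assms])
  qed
next
  assume pos: "\<forall>v. (\<exists>i<p. v i \<noteq> 0) \<longrightarrow> 0 < (\<Sum>i<p. \<Sum>j<p. cnj (v i) * A $$ (i, j) * v j)"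
  show "positive_definite A"
    unfolding positive_definite_def
  proof (intro conjI ballI impI)
    fix v :: "complex Matrix.vec" assume v: "v \<in> carrier_vec (dim_row A)" "v \<noteq> 0\<^sub>v (dim_row A)"
    hence "\<exists>i<p. v $ i \<noteq> 0" using assms by (auto simp: Matrix.vec_eq_iff)
    thus "0 < (A *\<^sub>v v) \<bullet>c v"
      using pos v assms by (simp add: quadratic_form_sum[OF assms])
  qed (use assms in simp)
qed

lemma superpositive_iff:
  assumes "M \<in> carrier_mat p p"
  shows "superpositive M \<longleftrightarrow> M\<^sup>\<star> = M \<and> positive_definite (body_mat M)"
proof -
  have "M\<^sup>\<star> = M \<longleftrightarrow> (\<forall>i<p. \<forall>j<p. (M $$ (j, i))\<^sup>\<dagger> = M $$ (i, j))"
    using assms by (auto simp: mat_eq_iff super_adjoint_def)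
  moreover have "body_mat M \<in> carrier_mat p p" using assms by simp
  moreover have "(\<Sum>i<p. \<Sum>j<p. cnj (v i) * body_mat M $$ (i, j) * v j) =
      (\<Sum>i<p. \<Sum>j<p. cnj (v i) * body (M $$ (i, j)) * v j)" for v
    using assms by simp
  ultimately show ?thesis
    unfolding superpositive_iff_form[OF assms] form_superpos_iff
    by (simp only: positive_definite_iff)
qed

text \<open>The form of \<open>L * D * L\<^sup>\<star>\<close> at \<open>c\<close> is that of
  \<open>D\<close> at \<open>y = L\<^sup>\<star> * c\<close>, so \<open>y\<close> must have nonzero
  body. At the last index \<open>k\<close> where the body of \<open>c\<close> is nonzero,
  triangularity leaves the single term from \<open>L $$ (k, k)\<close>, whose body is nonzero. This
  is the way back from either factorisation.\<close>

lemma superpositive_congruence: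
  assumes D: "D \<in> carrier_mat p p" "superpositive D"
    and L: "L \<in> carrier_mat p p" "lower_triangular L" "superpos_diagonal L"
  shows "superpositive (L * D * L\<^sup>\<star>)"
  unfolding superpositive_def
proof (intro conjI ballI impI)
  have LDL: "L * D * L\<^sup>\<star> \<in> carrier_mat p p"
    using D L by (intro mult_carrier_mat[of _ p p]) auto
  thus "square_mat (L * D * L\<^sup>\<star>)" by (metis carrier_matD square_mat.simps)
  fix c assume "c \<in> carrier_mat (dim_row (L * D * L\<^sup>\<star>)) 1"
    "body_mat c \<noteq> 0\<^sub>m (dim_row (L * D * L\<^sup>\<star>)) 1"
  hence c: "c \<in> carrier_mat p 1" "body_mat c \<noteq> 0\<^sub>m p 1" using LDL by auto
  define y where "y = L\<^sup>\<star> * c"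
  have y: "y \<in> carrier_mat p 1" using L c by (simp add: y_def mult_carrier_mat[of _ p p])
  define K where "K = {i. i < p \<and> body (c $$ (i, 0)) \<noteq> 0}"
  have "finite K" "K \<noteq> {}" using c by (auto simp: K_def body_mat_column_eq_0_iff)
  define k where "k = Max K"
  have k: "k < p" "body (c $$ (k, 0)) \<noteq> 0"
    using Max_in[OF \<open>finite K\<close> \<open>K \<noteq> {}\<close>] by (auto simp: k_def K_def)
  have "body (y $$ (k, 0)) = (\<Sum>j<p. cnj (body (L $$ (j, k))) * body (c $$ (j, 0)))"
    using L c k by (simp add: y_def index_mult_mat_sum[of _ p p _ 1] body_sum del: index_mult_mat)
  \<comment> \<open>Terms with \<open>j < k\<close> vanish because \<open>L\<close> is lower
    triangular, terms with \<open>j > k\<close> by the maximality of \<open>k\<close>.\<close>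
  also have "\<dots> = (\<Sum>j<p. if j = k then cnj (body (L $$ (k, k))) * body (c $$ (k, 0)) else 0)"
  proof (rule sum.cong)
    fix j assume j: "j \<in> {..<p}"
    have "L $$ (j, k) = 0" if "j < k" using L k that by (auto simp: lower_triangular_def)
    moreover have "body (c $$ (j, 0)) = 0" if "k < j"
    proof (rule ccontr)
      assume "body (c $$ (j, 0)) \<noteq> 0"
      hence "j \<in> K" using j by (simp add: K_def)
      thus False using Max_ge[OF \<open>finite K\<close>, of j] that by (simp add: k_def)
    qed
    ultimately show "cnj (body (L $$ (j, k))) * body (c $$ (j, 0)) =
        (if j = k then cnj (body (L $$ (k, k))) * body (c $$ (k, 0)) else 0)"
      by (cases j k rule: linorder_cases) auto
  qed simp
  also have "\<dots> \<noteq> 0"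
    using L k by (auto simp: superpos_diagonal_def superpos_iff)
  finally have "body_mat y \<noteq> 0\<^sub>m p 1"
    unfolding body_mat_column_eq_0_iff[OF y] using k by blast
  hence "superpos ((y\<^sup>\<star> * D * y) $$ (0, 0))"
    using D y unfolding superpositive_def by (metis carrier_matD(1))
  also have "y\<^sup>\<star> = c\<^sup>\<star> * L"
    using super_adjoint_mult[of "L\<^sup>\<star>" p p c 1] L c by (simp add: y_def)
  also have "c\<^sup>\<star> * L * D * y = c\<^sup>\<star> * (L * D * L\<^sup>\<star>) * c"
  proof -
    have carrier: "c\<^sup>\<star> \<in> carrier_mat 1 p" "L\<^sup>\<star> \<in> carrier_mat p p" "L * D \<in> carrier_mat p p"
      "c\<^sup>\<star> * (L * D) \<in> carrier_mat 1 p"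
      using D L c by (auto intro!: mult_carrier_mat[of _ _ p])
    have "c\<^sup>\<star> * L * D * y = c\<^sup>\<star> * (L * D) * (L\<^sup>\<star> * c)"
      unfolding y_def by (simp only: assoc_mult_mat[OF carrier(1) L(1) D(1)])
    also have "\<dots> = c\<^sup>\<star> * (L * D) * L\<^sup>\<star> * c"
      by (rule assoc_mult_mat[OF carrier(4,2) c(1), symmetric])
    also have "\<dots> = c\<^sup>\<star> * (L * D * L\<^sup>\<star>) * c"
      by (simp only: assoc_mult_mat[OF carrier(1,3,2)])
    finally show ?thesis .
  qed
  finally show "superpos ((c\<^sup>\<star> * (L * D * L\<^sup>\<star>) * c) $$ (0, 0))" .
qed

text \<open>Lets \<open>L * L\<^sup>\<star>\<close> be read as the congruence
  \<open>L * 1\<^sub>m p * L\<^sup>\<star>\<close>.\<close>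

lemma superpositive_one: "superpositive (1\<^sub>m p)"
proof -
  have "form_superpos p (\<lambda>i j. 1\<^sub>m p $$ (i, j)) \<longleftrightarrow> form_superpos p (\<lambda>i j. if i = j then 1 else 0)"
    by (simp add: form_superpos_iff)
  thus ?thesis
    using form_superpos_diagonal[of p "\<lambda>_. 1"] superpos_one
    by (simp add: superpositive_iff_form[of _ p])
qed

section \<open>Existence of the factorisations\<close>

lemma superpositive_LDL:
  assumes M: "M \<in> carrier_mat p p" "superpositive M"
  shows "\<exists>L D. L \<in> carrier_mat p p \<and> D \<in> carrier_mat p p \<and> diagonal_mat D \<and> superpositive D
    \<and> lower_triangular L \<and> unit_diagonal L \<and> M = L * D * L\<^sup>\<star>"
proof -
  have form: "form_superpos p (\<lambda>i j. M $$ (i, j))" using M superpositive_iff_form by blast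
  obtain l d where ld: "\<And>i. l i i = 1" "\<And>i j. i < j \<Longrightarrow> l i j = 0" "\<And>k. k < p \<Longrightarrow> superpos (d k)"
    "\<And>i j. i < p \<Longrightarrow> j < p \<Longrightarrow> M $$ (i, j) = (\<Sum>k<p. l i k * d k * (l j k)\<^sup>\<dagger>)"
    using form_superpos_LDL[OF form] by blast
  define L where "L = mat p p (\<lambda>(i, j). l i j)"
  define D where "D = mat p p (\<lambda>(i, j). if i = j then d i else 0)"
  have L: "L \<in> carrier_mat p p" "\<And>i j. i < p \<Longrightarrow> j < p \<Longrightarrow> L $$ (i, j) = l i j"
    by (auto simp: L_def)
  have D: "D \<in> carrier_mat p p" "\<And>i j. i < p \<Longrightarrow> j < p \<Longrightarrow> D $$ (i, j) = (if i = j then d i else 0)"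
    by (auto simp: D_def)
  have LD: "L * D \<in> carrier_mat p p" using L D by (simp add: mult_carrier_mat[of _ p p])
  have "(L * D) $$ (i, k) = l i k * d k" if "i < p" "k < p" for i k
  proof -
    have "(L * D) $$ (i, k) = (\<Sum>j<p. if j = k then l i k * d k else 0)"
      unfolding index_mult_mat_sum[OF L(1) D(1) that]
      by (rule sum.cong) (use that in \<open>auto simp: L(2) D(2)\<close>)
    thus ?thesis using that by simp
  qed
  hence "M = L * D * L\<^sup>\<star>"
    using L(2) ld(4) by (intro eq_mult_super_adjointI[OF M(1) LD L(1)]) simp
  \<comment> \<open>The two families agree below \<open>p\<close>, and the criterion reads no other
    entries.\<close>
  moreover have "form_superpos p (\<lambda>i j. D $$ (i, j)) \<longleftrightarrow>
      form_superpos p (\<lambda>i j. if i = j then d i else 0)"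
    by (simp add: form_superpos_iff D(2))
  hence "superpositive D"
    using form_superpos_diagonal ld(3) by (simp add: superpositive_iff_form[OF D(1)])
  moreover have "diagonal_mat D" "lower_triangular L" "unit_diagonal L"
    by (auto simp: diagonal_mat_def lower_triangular_def unit_diagonal_def D_def L_def ld)
  ultimately show ?thesis using L(1) D(1) by blast
qed

lemma superpositive_Cholesky_lower:
  assumes M: "M \<in> carrier_mat p p" "superpositive M"
  shows "\<exists>L. L \<in> carrier_mat p p \<and> lower_triangular L \<and> superpos_diagonal L \<and> M = L * L\<^sup>\<star>"
proof -
  have form: "form_superpos p (\<lambda>i j. M $$ (i, j))" using M superpositive_iff_form by blast
  obtain l where l: "\<And>i. i < p \<Longrightarrow> superpos (l i i)" "\<And>i j. j < p \<Longrightarrow> i < j \<Longrightarrow> l i j = 0"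
    "\<And>i j. i < p \<Longrightarrow> j < p \<Longrightarrow> M $$ (i, j) = (\<Sum>k<p. l i k * (l j k)\<^sup>\<dagger>)"
    using form_superpos_Cholesky[OF form] by blast
  define L where "L = mat p p (\<lambda>(i, j). l i j)"
  have L: "L \<in> carrier_mat p p" "\<And>i j. i < p \<Longrightarrow> j < p \<Longrightarrow> L $$ (i, j) = l i j"
    by (auto simp: L_def)
  hence "M = L * L\<^sup>\<star>"
    using l(3) by (intro eq_mult_super_adjointI[OF M(1) L(1) L(1)]) simp
  moreover have "lower_triangular L" "superpos_diagonal L"
    by (auto simp: lower_triangular_def superpos_diagonal_def L_def l)
  ultimately show ?thesis using L(1) by blast
qed

lemma superpositive_Cholesky_upper:
  assumes M: "M \<in> carrier_mat p p" "superpositive M"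
  shows "\<exists>U. U \<in> carrier_mat p p \<and> upper_triangular U \<and> superpos_diagonal U \<and> M = U * U\<^sup>\<star>"
proof -
  have "form_superpos p (\<lambda>i j. M $$ (p - Suc i, p - Suc j))"
    using M superpositive_iff_form form_superpos_reverse[of p "\<lambda>i j. M $$ (i, j)"] by blast
  then obtain l where l: "\<And>i. i < p \<Longrightarrow> superpos (l i i)" "\<And>i j. j < p \<Longrightarrow> i < j \<Longrightarrow> l i j = 0"
    "\<And>i j. i < p \<Longrightarrow> j < p \<Longrightarrow> M $$ (p - Suc i, p - Suc j) = (\<Sum>k<p. l i k * (l j k)\<^sup>\<dagger>)"
    using form_superpos_Cholesky[of p "\<lambda>i j. M $$ (p - Suc i, p - Suc j)"] by blast
  \<comment> \<open>For \<open>j < i\<close> the reversed indices satisfy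
    \<open>p - Suc i < p - Suc j\<close>, so the zeros of \<open>l\<close> above its diagonal become
    zeros of \<open>U\<close> below its own.\<close>
  define U where "U = mat p p (\<lambda>(i, j). l (p - Suc i) (p - Suc j))"
  have U: "U \<in> carrier_mat p p"
    "\<And>i j. i < p \<Longrightarrow> j < p \<Longrightarrow> U $$ (i, j) = l (p - Suc i) (p - Suc j)"
    by (auto simp: U_def)
  have "M $$ (i, j) = (\<Sum>k<p. U $$ (i, k) * (U $$ (j, k))\<^sup>\<dagger>)" if ij: "i < p" "j < p" for i j
  proof -
    have "M $$ (i, j) = (\<Sum>k<p. l (p - Suc i) k * (l (p - Suc j) k)\<^sup>\<dagger>)"
      using ij l(3)[of "p - Suc i" "p - Suc j"] by (simp add: Suc_diff_Suc)
    \<comment> \<open>The summation index is reversed too, to match the columns of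
      \<open>U\<close>.\<close>
    also have "\<dots> = (\<Sum>k<p. l (p - Suc i) (p - Suc k) * (l (p - Suc j) (p - Suc k))\<^sup>\<dagger>)"
      by (rule sum.nat_diff_reindex[symmetric])
    finally show ?thesis using ij by (simp add: U(2))
  qed
  hence "M = U * U\<^sup>\<star>"
    by (rule eq_mult_super_adjointI[OF M(1) U(1) U(1)])
  moreover have "upper_triangular U" "superpos_diagonal U"
    by (auto simp: superpos_diagonal_def U_def l)
  ultimately show ?thesis using U(1) by blast
qed

text \<open>Each of the other statements is compared with \<open>superpositive M\<close>. The
  Cholesky diagonals are required to be positive rather than one because the roots of the pivots
  stand there; \<open>no_unit_diagonal_Cholesky\<close> shows that ones can fail already for
  \<open>p = 1\<close>.\<close>

theorem theorem3p10:
  fixes M :: "supernumber mat" and p :: nat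
  assumes "M \<in> carrier_mat p p"
  shows "(superpositive M \<longleftrightarrow> M\<^sup>\<star> = M \<and> positive_definite (body_mat M))
    \<and> (superpositive M \<longleftrightarrow>
        (\<exists>L D U. L \<in> carrier_mat p p \<and> D \<in> carrier_mat p p \<and> U \<in> carrier_mat p p
          \<and> diagonal_mat D \<and> superpositive D
          \<and> lower_triangular L \<and> unit_diagonal L \<and> U = L\<^sup>\<star>
          \<and> M = L * D * U))
    \<and> (superpositive M \<longleftrightarrow>
        (\<exists>L U. L \<in> carrier_mat p p \<and> U \<in> carrier_mat p p
          \<and> lower_triangular L \<and> superpos_diagonal L
          \<and> upper_triangular U \<and> superpos_diagonal U
          \<and> M = L * L\<^sup>\<star> \<and> M = U * U\<^sup>\<star>))"
proof (intro conjI)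
  show "superpositive M \<longleftrightarrow> M\<^sup>\<star> = M \<and> positive_definite (body_mat M)"
    by (rule superpositive_iff[OF assms])
  show "superpositive M \<longleftrightarrow>
        (\<exists>L D U. L \<in> carrier_mat p p \<and> D \<in> carrier_mat p p \<and> U \<in> carrier_mat p p
          \<and> diagonal_mat D \<and> superpositive D
          \<and> lower_triangular L \<and> unit_diagonal L \<and> U = L\<^sup>\<star>
          \<and> M = L * D * U)" (is "_ \<longleftrightarrow> ?LDU")
  proof
    assume "superpositive M"
    thus ?LDU using superpositive_LDL[OF assms] super_adjoint_carrier by blast
  next
    assume ?LDU
    thus "superpositive M"
      using superpositive_congruence unit_diagonal_imp_superpos_diagonal by blast
  qed
  show "superpositive M \<longleftrightarrow>
        (\<exists>L U. L \<in> carrier_mat p p \<and> U \<in> carrier_mat p p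
          \<and> lower_triangular L \<and> superpos_diagonal L
          \<and> upper_triangular U \<and> superpos_diagonal U
          \<and> M = L * L\<^sup>\<star> \<and> M = U * U\<^sup>\<star>)" (is "_ \<longleftrightarrow> ?Cholesky")
  proof
    assume "superpositive M"
    then obtain L U where "L \<in> carrier_mat p p" "lower_triangular L" "superpos_diagonal L"
        "M = L * L\<^sup>\<star>" "U \<in> carrier_mat p p" "upper_triangular U" "superpos_diagonal U" "M = U * U\<^sup>\<star>"
      using superpositive_Cholesky_lower[OF assms] superpositive_Cholesky_upper[OF assms] by blast
    thus ?Cholesky by blast
  next
    assume ?Cholesky
    then obtain L where L: "L \<in> carrier_mat p p" "lower_triangular L" "superpos_diagonal L"
      "M = L * L\<^sup>\<star>" by blast
    have "superpositive (L * 1\<^sub>m p * L\<^sup>\<star>)"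
      by (rule superpositive_congruence) (use L superpositive_one in auto)
    thus "superpositive M" using L by simp
  qed
qed

end
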